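(* There is an algorithm which, given a string $T$ of length $n$ over an alphabet $\Sigma$ (reading $T$ letter by letter from left to right), computes the Z-normal form $\widehat{T}$ of $T$ in $\mathrm{O}(n)$ time.
   Context: Strings are finite sequences over an alphabet $\Sigma$; $\varepsilon$ is the empty string, $|w|$ the length, $w[i]$ the $i$-th letter, $\overline{w}=w[|w|]\cdots w[1]$ the reverse. A Z-shape is a string of the form $y\overline{y}y$ with $y$ nonempty. The reduction relation $\to$ on nonempty strings is defined by $xy\overline{y}yz \to xyz$ for all strings $x,z$ and nonempty strings $y$ (i.e., an occurrence of a Z-shape $y\overline{y}y$ is contracted to $y$). A string is irreducible if no reduction applies to it. It is known (Aslam and Rivest) that every string $w$ reduces, by $\to^*$ (the reflexive transitive closure of $\to$), to a unique irreducible string, called the Z-normal form of $w$ and denoted $\widehat{w}$. Comparisons of letters take constant time. *)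

theory Defs
  imports Complex_Main "HOL-Library.Landau_Symbols"
begin

section \<open>Z-shapes and Z-normal forms\<close>

definition Z_shape :: "'a list \<Rightarrow> bool" where
  "Z_shape u \<longleftrightarrow> (\<exists>y. y \<noteq> [] \<and> u = y @ rev y @ y)"

definition Z_red :: "'a list \<Rightarrow> 'a list \<Rightarrow> bool" (infix \<open>\<rightarrow>\<^sub>Z\<close> 50) where
  "u \<rightarrow>\<^sub>Z v \<longleftrightarrow> (\<exists>x y z. y \<noteq> [] \<and> u = x @ y @ rev y @ y @ z \<and> v = x @ y @ z)"

lemma Z_red_iff_Z_shape: "(\<exists>v. u \<rightarrow>\<^sub>Z v) \<longleftrightarrow> (\<exists>x s z. Z_shape s \<and> u = x @ s @ z)"
proof
  assume "\<exists>v. u \<rightarrow>\<^sub>Z v"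
  then obtain x y z where "y \<noteq> []" "u = x @ (y @ rev y @ y) @ z"
    unfolding Z_red_def by auto
  then show "\<exists>x s z. Z_shape s \<and> u = x @ s @ z"
    unfolding Z_shape_def by blast
next
  assume "\<exists>x s z. Z_shape s \<and> u = x @ s @ z"
  then obtain x y z where "y \<noteq> []" "u = x @ y @ rev y @ y @ z"
    unfolding Z_shape_def by auto
  then show "\<exists>v. u \<rightarrow>\<^sub>Z v"
    unfolding Z_red_def by blast
qed

definition Z_irreducible :: "'a list \<Rightarrow> bool" where
  "Z_irreducible u \<longleftrightarrow> \<not> (\<exists>v. u \<rightarrow>\<^sub>Z v)"

text \<open>The description operator is justified by the theorem of Aslam and Rivest: every string
  reduces to exactly one irreducible string.\<close>

definition Z_nf :: "'a list \<Rightarrow> 'a list" where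
  "Z_nf w = (THE v. Z_red\<^sup>*\<^sup>* w v \<and> Z_irreducible v)"

section \<open>The machine model\<close>

text \<open>
  Programs run on a unit-cost random access machine with a bounded word size. There are finitely
  many (those named in the program) integer variables, integer arrays and letter arrays. The input
  is on a one-way tape, accessible only by reading the next letter into a cell, and the output is
  written to a one-way tape. The syntax does not mention the alphabet: letters are opaque and can
  only be read, copied, tested for equality and written.
\<close>

type_synonym vname = string

datatype aexp =
    N nat
  | V vname
  | Arr vname aexp
  | Plus aexp aexp
  | Minus aexp aexp

datatype bexp =
    Leq aexp aexp
  | LetterEq vname aexp vname aexp
  | EndOfInput
  | Neg bexp
  | Conj bexp bexp

datatype com =
    Skip
  | Assign vname aexp
  | Store vname aexp aexp
  | Move vname aexp vname aexp
  | Read vname aexp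
  | Write vname aexp
  | Seq com com
  | Cond bexp com com
  | Loop bexp com

text \<open>In \<open>letters\<close>, the value \<open>None\<close> marks a cell that has not been written yet.\<close>

record 'a state =
  vars :: "vname \<Rightarrow> nat"
  arrs :: "vname \<Rightarrow> nat \<Rightarrow> nat"
  letters :: "vname \<Rightarrow> nat \<Rightarrow> 'a option"
  inp :: "'a list"
  outp :: "'a list"

definition init :: "'a list \<Rightarrow> 'a state" where
  "init T = \<lparr>vars = (\<lambda>_. 0), arrs = (\<lambda>_ _. 0), letters = (\<lambda>_ _. None), inp = T, outp = []\<rparr>"

text \<open>Subtraction is truncated at zero.\<close>

primrec aval :: "aexp \<Rightarrow> 'a state \<Rightarrow> nat" where
  "aval (N n) s = n"
| "aval (V x) s = vars s x"
| "aval (Arr A e) s = arrs s A (aval e s)"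
| "aval (Plus e1 e2) s = aval e1 s + aval e2 s"
| "aval (Minus e1 e2) s = aval e1 s - aval e2 s"

primrec bval :: "bexp \<Rightarrow> 'a state \<Rightarrow> bool" where
  "bval (Leq e1 e2) s \<longleftrightarrow> aval e1 s \<le> aval e2 s"
| "bval (LetterEq A e1 B e2) s \<longleftrightarrow> letters s A (aval e1 s) = letters s B (aval e2 s)"
| "bval EndOfInput s \<longleftrightarrow> inp s = []"
| "bval (Neg b) s \<longleftrightarrow> \<not> bval b s"
| "bval (Conj b1 b2) s \<longleftrightarrow> bval b1 s \<and> bval b2 s"

primrec acost :: "aexp \<Rightarrow> nat" where
  "acost (N n) = 1"
| "acost (V x) = 1"
| "acost (Arr A e) = 1 + acost e"
| "acost (Plus e1 e2) = 1 + acost e1 + acost e2"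
| "acost (Minus e1 e2) = 1 + acost e1 + acost e2"

primrec bcost :: "bexp \<Rightarrow> nat" where
  "bcost (Leq e1 e2) = 1 + acost e1 + acost e2"
| "bcost (LetterEq A e1 B e2) = 1 + acost e1 + acost e2"
| "bcost EndOfInput = 1"
| "bcost (Neg b) = 1 + bcost b"
| "bcost (Conj b1 b2) = 1 + bcost b1 + bcost b2"

text \<open>
  \<open>exec W c s k s'\<close>: started in \<open>s\<close>, program \<open>c\<close> terminates in \<open>s'\<close> after \<open>k\<close> time units, and all
  numbers it stores and all addresses it writes to are at most \<open>W\<close>. A run that would exceed \<open>W\<close>,
  read past the end of the input, or output an unwritten cell has no result.
\<close>

inductive exec :: "nat \<Rightarrow> com \<Rightarrow> 'a state \<Rightarrow> nat \<Rightarrow> 'a state \<Rightarrow> bool" for W :: nat where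
  Skip: "exec W Skip s 1 s"
| Assign: "aval e s \<le> W \<Longrightarrow>
    exec W (Assign x e) s (1 + acost e) (s\<lparr>vars := (vars s)(x := aval e s)\<rparr>)"
| Store: "\<lbrakk>aval e1 s \<le> W; aval e2 s \<le> W\<rbrakk> \<Longrightarrow>
    exec W (Store A e1 e2) s (1 + acost e1 + acost e2)
      (s\<lparr>arrs := (arrs s)(A := (arrs s A)(aval e1 s := aval e2 s))\<rparr>)"
| Move: "aval e1 s \<le> W \<Longrightarrow>
    exec W (Move A e1 B e2) s (1 + acost e1 + acost e2)
      (s\<lparr>letters := (letters s)(A := (letters s A)(aval e1 s := letters s B (aval e2 s)))\<rparr>)"
| Read: "\<lbrakk>aval e s \<le> W; inp s = a # as\<rbrakk> \<Longrightarrow>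
    exec W (Read A e) s (1 + acost e)
      (s\<lparr>letters := (letters s)(A := (letters s A)(aval e s := Some a)), inp := as\<rparr>)"
| Write: "letters s A (aval e s) = Some a \<Longrightarrow>
    exec W (Write A e) s (1 + acost e) (s\<lparr>outp := outp s @ [a]\<rparr>)"
| Seq: "\<lbrakk>exec W c1 s k1 s'; exec W c2 s' k2 s''\<rbrakk> \<Longrightarrow> exec W (Seq c1 c2) s (k1 + k2) s''"
| CondTrue: "\<lbrakk>bval b s; exec W c1 s k s'\<rbrakk> \<Longrightarrow> exec W (Cond b c1 c2) s (bcost b + k) s'"
| CondFalse: "\<lbrakk>\<not> bval b s; exec W c2 s k s'\<rbrakk> \<Longrightarrow> exec W (Cond b c1 c2) s (bcost b + k) s'"
| LoopFalse: "\<not> bval b s \<Longrightarrow> exec W (Loop b c) s (bcost b) s"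
| LoopTrue: "\<lbrakk>bval b s; exec W c s k1 s'; exec W (Loop b c) s' k2 s''\<rbrakk> \<Longrightarrow>
    exec W (Loop b c) s (bcost b + k1 + k2) s''"

inductive_cases exec_SkipE: "exec W Skip s k s'"
inductive_cases exec_AssignE: "exec W (Assign x e) s k s'"
inductive_cases exec_StoreE: "exec W (Store A e1 e2) s k s'"
inductive_cases exec_MoveE: "exec W (Move A e1 B e2) s k s'"
inductive_cases exec_ReadE: "exec W (Read A e) s k s'"
inductive_cases exec_WriteE: "exec W (Write A e) s k s'"
inductive_cases exec_SeqE: "exec W (Seq c1 c2) s k s'"
inductive_cases exec_CondE: "exec W (Cond b c1 c2) s k s'"
inductive_cases exec_LoopE: "exec W (Loop b c) s k s'"

lemma exec_deterministic:
  assumes "exec W c s k t" and "exec W c s k' t'"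
  shows "k' = k \<and> t' = t"
  using assms
proof (induction arbitrary: k' t' rule: exec.induct)
  case (Skip s)
  then show ?case by (elim exec_SkipE) simp
next
  case (Assign e s x)
  from Assign.prems show ?case by (elim exec_AssignE) simp
next
  case (Store e1 s e2 A)
  from Store.prems show ?case by (elim exec_StoreE) simp
next
  case (Move e1 s A B e2)
  from Move.prems show ?case by (elim exec_MoveE) simp
next
  case (Read e s a as A)
  from Read.prems Read.hyps show ?case by (elim exec_ReadE) simp
next
  case (Write s A e a)
  from Write.prems Write.hyps show ?case by (elim exec_WriteE) simp
next
  case (Seq c1 s k1 s' c2 k2 s'')
  from Seq.prems obtain l1 l2 u where
    "exec W c1 s l1 u" "exec W c2 u l2 t'" "k' = l1 + l2"
    by (elim exec_SeqE)
  with Seq.IH show ?case by metis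
next
  case (CondTrue b s c1 k s' c2)
  from CondTrue.prems CondTrue.hyps obtain l where "exec W c1 s l t'" "k' = bcost b + l"
    by (elim exec_CondE) simp_all
  with CondTrue.IH show ?case by metis
next
  case (CondFalse b s c2 k s' c1)
  from CondFalse.prems CondFalse.hyps obtain l where "exec W c2 s l t'" "k' = bcost b + l"
    by (elim exec_CondE) simp_all
  with CondFalse.IH show ?case by metis
next
  case (LoopFalse b s c)
  from LoopFalse.prems show ?case by (rule exec_LoopE) (use LoopFalse.hyps in simp_all)
next
  case (LoopTrue b s c k1 s' k2 s'')
  from LoopTrue.prems obtain l1 l2 u where
    "exec W c s l1 u" "exec W (Loop b c) u l2 t'" "k' = bcost b + l1 + l2"
    by (rule exec_LoopE) (use LoopTrue.hyps in simp_all)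
  with LoopTrue.IH show ?case by metis
qed

text \<open>
  A single program works for inputs of all lengths \<open>n\<close>; \<open>time n\<close> bounds its worst-case running time,
  \<open>W n\<close> the numbers it uses. With \<open>W\<close> in \<open>O(n)\<close>, words of \<open>log\<^sub>2 n + O(1)\<close> bits suffice, so that
  unit-cost arithmetic on large numbers cannot be exploited.
\<close>

definition computes ::
    "com \<Rightarrow> ('a list \<Rightarrow> 'a list) \<Rightarrow> (nat \<Rightarrow> nat) \<Rightarrow> (nat \<Rightarrow> nat) \<Rightarrow> bool" where
  "computes c f W time \<longleftrightarrow>
     (\<forall>T. \<exists>k s. exec (W (length T)) c (init T) k s \<and> outp s = f T \<and> k \<le> time (length T))"

end

theory Submission
  imports Defs
begin

text \<open>
  The normal form is computed by keeping an irreducible string \<open>w\<close> as a stack: push the next letter, and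
  if this completes a Z-shape \<open>y @ rev y @ y\<close>, pop its last \<open>2 * length y\<close> letters. The popped string is
  a prefix of \<open>w\<close>, hence irreducible again.

  A Z-shape is a pair of even palindromes of radius at least \<open>d\<close> whose centres have distance \<open>d\<close>, so
  in an irreducible string such centres are far apart. This makes it sufficient to know, for every prefix,
  the radius \<open>s\<close> of its shortest even suffix palindrome: length \<open>n\<close> completes a Z-shape iff
  \<open>s n = d > 0\<close> and \<open>s (n - d) = d\<close>. When a letter is pushed, the candidates for the new shortest suffix
  palindrome are the centres \<open>n\<close>, \<open>n - s n\<close>, and so on, and they are tested in constant amortised time by
  mirroring as in Manacher's algorithm. Rejected candidates disappear from this chain, each letter adds at
  most one element, and popping a Z-shape removes two; so the chain length is a potential that
  gives linear time.

  That the result does not depend on the order of reductions is proved by viewing a string as a walk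
  on a path graph.
\<close>

section \<open>Even palindromes and Z-shapes\<close>


text \<open>A centre \<open>c\<close> is the gap after the first \<open>c\<close> letters, so the
  palindrome occupies the indices from \<open>c - r\<close> to \<open>c + r - 1\<close>. The bounds
  keep the truncated subtractions harmless.\<close>

definition pal :: "'a list \<Rightarrow> nat \<Rightarrow> nat \<Rightarrow> bool" where
  "pal u c r \<longleftrightarrow> r \<le> c \<and> c + r \<le> length u \<and> (\<forall>j<r. u ! (c - 1 - j) = u ! (c + j))"

lemma palI:
  assumes "r \<le> c" "c + r \<le> length u"
    and "\<And>i j. i < c \<Longrightarrow> c \<le> j \<Longrightarrow> j < c + r \<Longrightarrow> i + j + 1 = 2 * c \<Longrightarrow> u ! i = u ! j"
  shows "pal u c r"
  unfolding pal_def using assms by auto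

lemma pal_nth:
  assumes "pal u c r" "i + j + 1 = 2 * c" "i < c + r" "j < c + r"
  shows "u ! i = u ! j"
proof -
  have *: "u ! i = u ! j" if "i < c" "i + j + 1 = 2 * c" "j < c + r" for i j
  proof -
    have "c - 1 - (j - c) = i" "c + (j - c) = j" "j - c < r" using that by auto
    then show ?thesis using assms(1) unfolding pal_def by metis
  qed
  show ?thesis
  proof (cases "i < c")
    case True
    then show ?thesis using * assms by blast
  next
    case False
    then have "u ! j = u ! i" using *[of j i] assms by simp
    then show ?thesis by simp
  qed
qed

lemma pal_le: "pal u c r \<Longrightarrow> r \<le> c" "pal u c r \<Longrightarrow> c + r \<le> length u"
  by (auto simp: pal_def)

lemma pal_mono: "pal u c r \<Longrightarrow> r' \<le> r \<Longrightarrow> pal u c r'"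
  by (auto simp: pal_def)

lemma pal_0: "c \<le> length u \<Longrightarrow> pal u c 0"
  by (simp add: pal_def)

lemma pal_append: "c + r \<le> length u \<Longrightarrow> pal (u @ v) c r \<longleftrightarrow> pal u c r"
  by (auto simp: pal_def nth_append)

lemma pal_take: "c + r \<le> l \<Longrightarrow> l \<le> length u \<Longrightarrow> pal (take l u) c r \<longleftrightarrow> pal u c r"
  by (auto simp: pal_def)

text \<open>\<open>c\<close> and \<open>c + d\<close> are the gaps on either side of the middle
  block of \<open>y @ rev y @ y\<close>, and \<open>d\<close> is the length of
  \<open>y\<close>.\<close>

definition Z_at :: "'a list \<Rightarrow> nat \<Rightarrow> nat \<Rightarrow> bool" where
  "Z_at u c d \<longleftrightarrow> 0 < d \<and> pal u c d \<and> pal u (c + d) d"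

lemma Z_atI_pal:
  assumes "pal u c r" "pal u c' r'" "c < c'" "c' - c \<le> r" "c' - c \<le> r'"
  shows "Z_at u c (c' - c)"
  using assms pal_mono by (auto simp: Z_at_def)

lemma Z_red_iff_Z_at:
  "u \<rightarrow>\<^sub>Z v \<longleftrightarrow> (\<exists>c d. Z_at u c d \<and> v = take c u @ drop (c + 2 * d) u)"
proof
  assume "u \<rightarrow>\<^sub>Z v"
  then obtain x y z where y: "y \<noteq> []" and u: "u = x @ y @ rev y @ y @ z" and v: "v = x @ y @ z"
    unfolding Z_red_def by blast
  let ?c = "length x + length y" and ?d = "length y"
  have "pal u ?c ?d"
    by (rule palI) (auto simp: u nth_append rev_nth intro!: arg_cong[of _ _ "nth y"])
  moreover have "pal u (?c + ?d) ?d"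
    by (rule palI) (auto simp: u nth_append rev_nth intro!: arg_cong[of _ _ "nth y"])
  ultimately have "Z_at u ?c ?d" using y by (simp add: Z_at_def)
  moreover have "v = take ?c u @ drop (?c + 2 * ?d) u"
    by (simp add: u v)
  ultimately show "\<exists>c d. Z_at u c d \<and> v = take c u @ drop (c + 2 * d) u" by blast
next
  assume "\<exists>c d. Z_at u c d \<and> v = take c u @ drop (c + 2 * d) u"
  then obtain c d where Z: "Z_at u c d" and v: "v = take c u @ drop (c + 2 * d) u" by blast
  then have d: "0 < d" and p1: "pal u c d" and p2: "pal u (c + d) d" by (auto simp: Z_at_def)
  note le = pal_le[OF p1] pal_le[OF p2]
  define y where "y = take d (drop (c - d) u)"
  have ly: "length y = d" using le by (simp add: y_def)
  have *: "u = take (c - d) u @ take d (drop (c - d) u) @ take d (drop c u) @ take d (drop (c + d) u)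
      @ drop (c + 2 * d) u"
  proof -
    have "drop (c - d) u = take d (drop (c - d) u) @ drop c u"
      using le append_take_drop_id[of d "drop (c - d) u"] by simp
    moreover have "drop c u = take d (drop c u) @ drop (c + d) u"
      using append_take_drop_id[of d "drop c u"] by (simp add: add.commute)
    moreover have "drop (c + d) u = take d (drop (c + d) u) @ drop (c + 2 * d) u"
      using append_take_drop_id[of d "drop (c + d) u"]
      by (simp add: mult_2 add.commute add.left_commute)
    ultimately show ?thesis by (metis append_take_drop_id)
  qed
  have y2: "take d (drop c u) = rev y"
  proof (rule nth_equalityI)
    show "length (take d (drop c u)) = length (rev y)" using le ly by simp
    fix i assume "i < length (take d (drop c u))"
    then have i: "i < d" by simp
    have "u ! (c + i) = u ! (c - Suc i)" using i le by (intro pal_nth[OF p1]) auto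
    then show "take d (drop c u) ! i = rev y ! i" using i le by (simp add: rev_nth ly y_def)
  qed
  have y3: "take d (drop (c + d) u) = y"
  proof (rule nth_equalityI)
    show "length (take d (drop (c + d) u)) = length y" using le ly by simp
    fix i assume "i < length (take d (drop (c + d) u))"
    then have i: "i < d" by simp
    have "u ! (c + d + i) = u ! (c + d - Suc i)" using i le by (intro pal_nth[OF p2]) auto
    also have "\<dots> = u ! (c - d + i)" using i le by (intro pal_nth[OF p1]) auto
    finally show "take d (drop (c + d) u) ! i = y ! i" using i le by (simp add: y_def)
  qed
  have tc: "take c u = take (c - d) u @ y"
    using le take_add[of "c - d" d u] by (simp add: y_def)
  have "u = take (c - d) u @ y @ rev y @ y @ drop (c + 2 * d) u"
    using * y2 y3 by (simp add: y_def)
  moreover have "v = take (c - d) u @ y @ drop (c + 2 * d) u"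
    by (simp add: v tc)
  moreover have "y \<noteq> []" using ly d by auto
  ultimately show "u \<rightarrow>\<^sub>Z v" unfolding Z_red_def by blast
qed

lemma Z_irreducible_iff_Z_at: "Z_irreducible u \<longleftrightarrow> \<not> (\<exists>c d. Z_at u c d)"
  unfolding Z_irreducible_def Z_red_iff_Z_at by blast

text \<open>Two successive reflections translate by \<open>2 * d\<close>, so a Z-shape has this
  period, and deleting its first two blocks amounts to deleting its last two.\<close>

lemma delete_shift:
  assumes "pal u c d" "pal u (c + d) d"
  shows "take (c - d) u @ drop (c + d) u = take c u @ drop (c + 2 * d) u"
proof (rule nth_equalityI)
  note le = pal_le[OF assms(1)] pal_le[OF assms(2)]
  show "length (take (c - d) u @ drop (c + d) u) = length (take c u @ drop (c + 2 * d) u)"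
    using le by simp
  fix i assume i: "i < length (take (c - d) u @ drop (c + d) u)"
  consider "i < c - d" | "c - d \<le> i" "i < c" | "c \<le> i" by linarith
  then show "(take (c - d) u @ drop (c + d) u) ! i = (take c u @ drop (c + 2 * d) u) ! i"
  proof cases
    case 1
    then have "i < c" by simp
    then show ?thesis using le 1 by (simp add: nth_append)
  next
    case 2
    have "u ! (i + 2 * d) = u ! (2 * c - i - 1)" using 2 le by (intro pal_nth[OF assms(2)]) auto
    also have "\<dots> = u ! i" using 2 le by (intro pal_nth[OF assms(1)]) auto
    finally have "u ! (i + 2 * d) = u ! i" .
    moreover have "c + d + (i - (c - d)) = i + 2 * d" using 2 le by simp
    ultimately have "u ! (c + d + (i - (c - d))) = u ! i" by metis
    then show ?thesis using le 2 by (simp add: nth_append)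
  next
    case 3
    have "c + d + (i - (c - d)) = c + 2 * d + (i - c)" using 3 le by simp
    then have "u ! (c + d + (i - (c - d))) = u ! (c + 2 * d + (i - c))" by (rule arg_cong)
    moreover have "\<not> i < c - d" "\<not> i < c" using 3 by auto
    ultimately show ?thesis using le by (simp add: nth_append)
  qed
qed

section \<open>Uniqueness of the Z-normal form\<close>

text \<open>A walk of \<open>u\<close> on the path graph whose edges are labelled by \<open>p\<close>, from its left to its right
  end: \<open>F i\<close> is the vertex reached after \<open>i\<close> letters. Reversing a reduction sequence from \<open>u\<close> to \<open>p\<close>
  yields such a walk.\<close>

definition walk :: "'a list \<Rightarrow> 'a list \<Rightarrow> (nat \<Rightarrow> nat) \<Rightarrow> bool" where
  "walk u p F \<longleftrightarrow> F 0 = 0 \<and> F (length u) = length p \<and>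
     (\<forall>i<length u. (F (Suc i) = Suc (F i) \<or> F i = Suc (F (Suc i))) \<and>
        F i \<le> length p \<and> u ! i = p ! min (F i) (F (Suc i)))"

definition turn :: "'a list \<Rightarrow> (nat \<Rightarrow> nat) \<Rightarrow> nat \<Rightarrow> bool" where
  "turn u F t \<longleftrightarrow> 0 < t \<and> t < length u \<and> F (t - 1) = F (t + 1)"

lemma walk_step:
  "walk u p F \<Longrightarrow> i < length u \<Longrightarrow> F (Suc i) = Suc (F i) \<or> F i = Suc (F (Suc i))"
  by (simp add: walk_def)

lemma walk_le: "walk u p F \<Longrightarrow> i \<le> length u \<Longrightarrow> F i \<le> length p"
  by (cases "i = length u") (auto simp: walk_def)

lemma walk_nth: "walk u p F \<Longrightarrow> i < length u \<Longrightarrow> u ! i = p ! min (F i) (F (Suc i))"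
  by (simp add: walk_def)

text \<open>Without an interior turn the direction of the first step persists. The descending case
  is written additively to avoid truncated subtraction.\<close>

lemma walk_straight:
  assumes w: "walk u p F" and "a \<le> b" "b \<le> length u" "\<And>t. a < t \<Longrightarrow> t < b \<Longrightarrow> \<not> turn u F t"
  shows "(\<forall>i\<in>{a..b}. F i = F a + (i - a)) \<or> (\<forall>i\<in>{a..b}. F i + (i - a) = F a)"
  using assms(2-)
proof (induction b rule: dec_induct)
  case base
  then show ?case by auto
next
  case (step b)
  then have IH: "(\<forall>i\<in>{a..b}. F i = F a + (i - a)) \<or> (\<forall>i\<in>{a..b}. F i + (i - a) = F a)" by simp
  have st: "F (Suc b) = Suc (F b) \<or> F b = Suc (F (Suc b))"
    using walk_step[OF w] step by simp
  show ?case
  proof (cases "b = a")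
    case True
    have "{a..Suc b} = {a, Suc a}" using True by auto
    then show ?thesis using st True by auto
  next
    case False
    then have "\<not> turn u F b" using step by simp
    then have nt: "F (b - 1) \<noteq> F (Suc b)" using step False by (simp add: turn_def)
    have b1: "b - 1 \<in> {a..b}" "b \<in> {a..b}" using step False by auto
    have ab: "a < b" using step False by simp
    have ins: "{a..Suc b} = insert (Suc b) {a..b}" using step by auto
    from IH show ?thesis
    proof
      assume A: "\<forall>i\<in>{a..b}. F i = F a + (i - a)"
      have "F b = F a + (b - a)" "F (b - 1) = F a + (b - 1 - a)" using A b1 by blast+
      then have "F (Suc b) = F a + (Suc b - a)" using st nt ab by arith
      then have "\<forall>i\<in>{a..Suc b}. F i = F a + (i - a)" unfolding ins using A by blast
      then show ?thesis ..
    next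
      assume A: "\<forall>i\<in>{a..b}. F i + (i - a) = F a"
      have "F b + (b - a) = F a" "F (b - 1) + (b - 1 - a) = F a" using A b1 by blast+
      then have "F (Suc b) + (Suc b - a) = F a" using st nt ab by arith
      then have "\<forall>i\<in>{a..Suc b}. F i + (i - a) = F a" unfolding ins using A by blast
      then show ?thesis ..
    qed
  qed
qed

text \<open>Since the walk starts at the leftmost and ends at the rightmost vertex, the two end segments are
  long enough even for an isolated turn near the boundary.\<close>

lemma isolated_turn:
  assumes w: "walk u p F" and t: "turn u F t"
    and sep: "\<And>t'. turn u F t' \<Longrightarrow> t' \<noteq> t \<Longrightarrow> t' + e \<le> t \<or> t + e \<le> t'"
  shows "e \<le> t" "t + e \<le> length u" "j \<le> e \<Longrightarrow> F (t - j) = F (t + j)"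
proof -
  let ?n = "length u"
  have t0: "0 < t" "t < ?n" "F (t - 1) = F (t + 1)" using t by (auto simp: turn_def)
  have F0: "F 0 = 0" "F ?n = length p" using w by (auto simp: walk_def)
  define a where "a = t - e"
  define b where "b = min ?n (t + e)"
  have L: "(\<forall>i\<in>{a..t}. F i = F a + (i - a)) \<or> (\<forall>i\<in>{a..t}. F i + (i - a) = F a)"
    by (rule walk_straight[OF w]) (use t0 sep in \<open>force simp: a_def\<close>)+
  have R: "(\<forall>i\<in>{t..b}. F i = F t + (i - t)) \<or> (\<forall>i\<in>{t..b}. F i + (i - t) = F t)"
    by (rule walk_straight[OF w]) (use t0 sep in \<open>force simp: b_def\<close>)+
  show *: "e \<le> t"
  proof (rule ccontr)
    assume "\<not> e \<le> t"
    then have a0: "a = 0" and e: "t < e" by (auto simp: a_def)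
    have "t \<in> {a..t}" "t - 1 \<in> {a..t}" using a0 by auto
    then have Ft: "F t = t" "F (t - 1) = t - 1" using L a0 F0 t0
      by (metis add_0 add_is_0 diff_zero)+
    have "Suc t \<in> {t..b}" using e t0 by (auto simp: b_def)
    then have dn: "\<forall>i\<in>{t..b}. F i + (i - t) = F t" using R Ft t0 by fastforce
    \<comment> \<open>The walk climbs to height \<open>t\<close> and then descends. Either it ends
      below the vertex \<open>length p\<close>, or it would have to go below 0.\<close>
    show False
    proof (cases "?n \<le> t + e")
      case True
      then have "b = ?n" by (simp add: b_def)
      then have "F ?n + (?n - t) = F t" using dn t0 by simp
      moreover have "F t \<le> length p" using walk_le[OF w] t0 by simp
      ultimately show False using F0 t0 by simp
    next
      case False
      then have "t + e \<in> {t..b}" by (simp add: b_def)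
      then have "F (t + e) + (t + e - t) = F t" using dn by blast
      then show False using Ft e by simp
    qed
  qed
  show **: "t + e \<le> ?n"
  proof (rule ccontr)
    assume "\<not> t + e \<le> ?n"
    then have b: "b = ?n" and e: "?n < t + e" by (auto simp: b_def)
    have le: "F t \<le> length p" "F a \<le> length p" using walk_le[OF w] t0 by (auto simp: a_def)
    have up: "\<forall>i\<in>{t..b}. F i = F t + (i - t)"
    proof -
      { assume "\<forall>i\<in>{t..b}. F i + (i - t) = F t"
        then have "F ?n + (?n - t) = F t" using b t0 by simp
        then have False using F0 t0 le by simp }
      then show ?thesis using R by blast
    qed
    have "Suc t \<in> {t..b}" "?n \<in> {t..b}" using b t0 by auto
    then have "F (Suc t) = F t + (Suc t - t)" and Fn: "F ?n = F t + (?n - t)" using up by blast+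
    then have FSt: "F (Suc t) = Suc (F t)" by simp
    have "\<forall>i\<in>{a..t}. F i + (i - a) = F a"
    proof -
      { assume A: "\<forall>i\<in>{a..t}. F i = F a + (i - a)"
        have "t - 1 \<in> {a..t}" "t \<in> {a..t}" using * e t0 by (auto simp: a_def)
        then have "F (t - 1) = F a + (t - 1 - a)" "F t = F a + (t - a)" using A by blast+
        then have False using t0 FSt by simp }
      then show ?thesis using L by blast
    qed
    moreover have "t \<in> {a..t}" by (simp add: a_def)
    ultimately have "F t + (t - a) = F a" by blast
    \<comment> \<open>The descent before \<open>t\<close> is longer than the final climb to
      \<open>length p\<close>, so it would start beyond that vertex.\<close>
    then show False using * e le F0 Fn t0 unfolding a_def by linarith
  qed
  show "F (t - j) = F (t + j)" if "j \<le> e"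
  proof (cases "j = 0")
    case False
    have mem: "t - 1 \<in> {a..t}" "t \<in> {a..t}" "t - j \<in> {a..t}" "t + j \<in> {t..b}" "t + 1 \<in> {t..b}"
      "t \<in> {t..b}" using False that * ** t0 by (auto simp: a_def b_def)
    have a: "a = t - e" "a + e = t" using * by (auto simp: a_def)
    show ?thesis
      using L
    proof
      assume A: "\<forall>i\<in>{a..t}. F i = F a + (i - a)"
      have l: "F (t - 1) = F a + (t - 1 - a)" "F t = F a + (t - a)" "F (t - j) = F a + (t - j - a)"
        using A mem by blast+
      have "\<not> (\<forall>i\<in>{t..b}. F i = F t + (i - t))"
      proof
        assume "\<forall>i\<in>{t..b}. F i = F t + (i - t)"
        then have "F (t + 1) = F t + (t + 1 - t)" using mem by blast
        then show False using l t0 by simp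
      qed
      then have "F (t + j) + (t + j - t) = F t" using R mem by blast
      then show ?thesis using l a that by linarith
    next
      assume A: "\<forall>i\<in>{a..t}. F i + (i - a) = F a"
      have l: "F (t - 1) + (t - 1 - a) = F a" "F t + (t - a) = F a" "F (t - j) + (t - j - a) = F a"
        using A mem by blast+
      have "\<not> (\<forall>i\<in>{t..b}. F i + (i - t) = F t)"
      proof
        assume "\<forall>i\<in>{t..b}. F i + (i - t) = F t"
        then have "F (t + 1) + (t + 1 - t) = F t" using mem by blast
        then show False using l t0 a False that by simp
      qed
      then have "F (t + j) = F t + (t + j - t)" using R mem by blast
      then show ?thesis using l a that by linarith
    qed
  qed simp
qed

text \<open>Mirrored steps traverse the same edge in opposite directions, and the label of an edge
  does not depend on the direction.\<close>

lemma isolated_turn_pal: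
  assumes w: "walk u p F" and t: "turn u F t"
    and sep: "\<And>t'. turn u F t' \<Longrightarrow> t' \<noteq> t \<Longrightarrow> t' + e \<le> t \<or> t + e \<le> t'"
  shows "pal u t e"
proof (rule palI)
  note I = isolated_turn[OF w t sep]
  show "e \<le> t" "t + e \<le> length u" using I(1,2) by blast+
  fix i j assume ij: "i < t" "t \<le> j" "j < t + e" "i + j + 1 = 2 * t"
  have "F (t - (j - t)) = F (t + (j - t))" "F (t - (Suc j - t)) = F (t + (Suc j - t))"
    by (rule I(3); use ij in simp)+
  moreover have "t - (j - t) = Suc i" "t - (Suc j - t) = i" using ij by auto
  ultimately have "F (Suc i) = F j" "F i = F (Suc j)" using ij by auto
  then show "u ! i = u ! j" using walk_nth[OF w, of i] walk_nth[OF w, of j] ij I(2)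
    by (simp add: min.commute)
qed

text \<open>Two turns at minimal distance are the two centres of a Z-shape.\<close>

lemma turns_separated:
  assumes w: "walk u p F" and noZ: "\<And>c k. k < d \<Longrightarrow> \<not> Z_at u c k"
    and t: "turn u F t" "turn u F t'" "t' \<noteq> t"
  shows "t' + d \<le> t \<or> t + d \<le> t'"
proof -
  define P where "P k \<longleftrightarrow> 0 < k \<and> (\<exists>t. turn u F t \<and> turn u F (t + k))" for k
  have Pdiff: "P (t2 - t1)" if "turn u F t1" "turn u F t2" "t1 < t2" for t1 t2
    unfolding P_def using that by (auto intro!: exI[of _ t1])
  then have ex: "\<exists>k. P k" using t by (metis nat_neq_iff)
  define m where "m = (LEAST k. P k)"
  have "P m" unfolding m_def using ex by (rule LeastI_ex)
  have min: "m \<le> k" if "P k" for k unfolding m_def using that by (rule Least_le)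
  have sep: "t2 + m \<le> t1 \<or> t1 + m \<le> t2" if "turn u F t1" "turn u F t2" "t2 \<noteq> t1" for t1 t2
  proof (cases "t1 < t2")
    case True
    then show ?thesis using min[OF Pdiff[of t1 t2]] that by simp
  next
    case False
    then show ?thesis using min[OF Pdiff[of t2 t1]] that by simp
  qed
  obtain t1 where t1: "0 < m" "turn u F t1" "turn u F (t1 + m)" using \<open>P m\<close> by (auto simp: P_def)
  have "Z_at u t1 m" unfolding Z_at_def
    using t1 sep by (auto intro!: isolated_turn_pal[OF w])
  then have "d \<le> m" using noZ by (meson not_le)
  then show ?thesis using sep[of t t'] t by auto
qed

text \<open>Turns would be arbitrarily far apart, so a turn would be isolated to a radius exceeding
  the length of \<open>u\<close>, which no palindrome has. A walk without turns reads
  \<open>p\<close> once from left to right.\<close>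

lemma walk_irreducible_eq:
  assumes w: "walk u p F" and "Z_irreducible u"
  shows "u = p"
proof -
  have noZ: "\<not> Z_at u c k" for c k using assms(2) by (simp add: Z_irreducible_iff_Z_at)
  have "\<not> turn u F t" for t
  proof
    assume t: "turn u F t"
    have "pal u t (Suc (length u))"
      by (rule isolated_turn_pal[OF w t]) (use turns_separated[OF w noZ] t in blast)
    then show False using pal_le by fastforce
  qed
  then have "(\<forall>i\<in>{0..length u}. F i = F 0 + (i - 0)) \<or> (\<forall>i\<in>{0..length u}. F i + (i - 0) = F 0)"
    by (intro walk_straight[OF w]) auto
  moreover have F0: "F 0 = 0" "F (length u) = length p" using w by (auto simp: walk_def)
  ultimately have F: "\<forall>i\<le>length u. F i = i" by (metis add_0 add_is_0 atLeastAtMost_iff diff_zero zero_le)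
  show ?thesis
  proof (rule nth_equalityI)
    show "length u = length p" using F F0 by simp
    show "u ! i = p ! i" if "i < length u" for i
      using walk_nth[OF w that] F that by simp
  qed
qed

section \<open>Transporting walks along contractions\<close>

lemma walk_expand:
  assumes Z: "Z_at u c d" and w: "walk (take c u @ drop (c + 2 * d) u) p F"
  shows "\<exists>G. walk u p G"
proof -
  have d: "0 < d" and p1: "pal u c d" and p2: "pal u (c + d) d" using Z by (auto simp: Z_at_def)
  note le = pal_le[OF p1] pal_le[OF p2]
  let ?v = "take c u @ drop (c + 2 * d) u"
  have lv: "length ?v = length u - 2 * d" using le by simp
  \<comment> \<open>The new walk retraces its last \<open>d\<close> steps before \<open>c\<close>
    and then repeats them.\<close>
  define G where "G i = (if i \<le> c then F i else if i \<le> c + d then F (2 * c - i) else F (i - 2 * d))" for i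
  have v1: "?v ! i = u ! i" if "i < c" for i using that le by (simp add: nth_append)
  have v2: "?v ! (i - 2 * d) = u ! i" if "c + 2 * d \<le> i" for i
  proof -
    have "\<not> i - 2 * d < c" "c + 2 * d + (i - 2 * d - c) = i" using that by auto
    then show ?thesis using le by (simp add: nth_append)
  qed
  have G: "(G (Suc i) = Suc (G i) \<or> G i = Suc (G (Suc i))) \<and>
        G i \<le> length p \<and> u ! i = p ! min (G i) (G (Suc i))" if i: "i < length u" for i
  proof -
    have st: "(F (Suc i) = Suc (F i) \<or> F i = Suc (F (Suc i))) \<and>
        F i \<le> length p \<and> F (Suc i) \<le> length p \<and> ?v ! i = p ! min (F i) (F (Suc i))"
      if "i < length u - 2 * d" for i
      using w that lv walk_le[OF w, of "Suc i"] unfolding walk_def by auto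
    consider "i < c" | "c \<le> i" "i < c + d" | "c + d \<le> i" "i < c + 2 * d" | "c + 2 * d \<le> i" by linarith
    then show ?thesis
    proof cases
      case 1
      then show ?thesis using st[of i] v1[of i] le by (simp add: G_def)
    next
      case 2
      define k where "k = 2 * c - Suc i"
      have k: "Suc k = 2 * c - i" "k = 2 * c - Suc i" "k < c" using 2 le by (auto simp: k_def)
      have uk: "u ! i = u ! k" using 2 le k by (intro pal_nth[OF p1]) auto
      have Gi: "G i = F (Suc k)" "G (Suc i) = F k"
        using 2 k by (auto simp: G_def)
      show ?thesis unfolding Gi uk using st[of k] v1[of k] k le by (auto simp: min.commute)
    next
      case 3
      define k where "k = i - 2 * d"
      have k: "i = k + 2 * d" "k < c" "c - d \<le> k" using 3 le by (auto simp: k_def)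
      have "u ! i = u ! (2 * c - Suc k)" using 3 le k by (intro pal_nth[OF p2]) auto
      also have "\<dots> = u ! k" using 3 le k by (intro pal_nth[OF p1]) auto
      finally have uk: "u ! i = u ! k" .
      have "2 * c - (c + d) = c - d" using le by simp
      then have Gi: "G i = F k" "G (Suc i) = F (Suc k)"
        using 3 k d by (auto simp: G_def le_Suc_eq)
      show ?thesis unfolding Gi uk using st[of k] v1[of k] k le by simp
    next
      case 4
      have "i - 2 * d < length u - 2 * d" using i 4 by simp
      then show ?thesis using st[of "i - 2 * d"] v2[of i] 4 d
        by (auto simp: G_def Suc_diff_le)
    qed
  qed
  have "G 0 = 0" "G (length u) = length p"
  proof -
    show "G 0 = 0" using w by (simp add: G_def walk_def)
    have "F (length u - 2 * d) = length p" using w lv by (simp add: walk_def)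
    then show "G (length u) = length p" using le d by (auto simp: G_def)
  qed
  then show ?thesis using G unfolding walk_def by blast
qed

text \<open>The deleted steps form a closed excursion, so the two remaining pieces join at the same
  vertex.\<close>

lemma walk_delete:
  assumes w: "walk u p F" and F: "F i = F (i + k)" and le: "i + k \<le> length u"
  shows "\<exists>G. walk (take i u @ drop (i + k) u) p G"
proof -
  let ?v = "take i u @ drop (i + k) u"
  define G where "G j = (if j \<le> i then F j else F (j + k))" for j
  have Gi: "G j = F (j + k)" if "i \<le> j" for j using that F by (auto simp: G_def)
  have lv: "length ?v = length u - k" using le by simp
  have "walk ?v p G"
    unfolding walk_def
  proof (intro conjI allI impI)
    show "G 0 = 0" using w by (simp add: G_def walk_def)
    show "G (length ?v) = length p" using Gi[of "length ?v"] lv le w by (simp add: walk_def)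
    fix j assume j: "j < length ?v"
    have "(G (Suc j) = Suc (G j) \<or> G j = Suc (G (Suc j))) \<and> G j \<le> length p \<and>
        ?v ! j = p ! min (G j) (G (Suc j))"
    proof (cases "j < i")
      case True
      then have "G j = F j" "G (Suc j) = F (Suc j)" "?v ! j = u ! j" "j < length u"
        using le by (auto simp: G_def nth_append)
      then show ?thesis using w by (simp add: walk_def)
    next
      case False
      then have "G j = F (j + k)" "G (Suc j) = F (Suc (j + k))" using Gi[of j] Gi[of "Suc j"] by auto
      moreover have "?v ! j = u ! (j + k)" using False le by (simp add: nth_append algebra_simps)
      moreover have "j + k < length u" using j lv by simp
      ultimately show ?thesis using w by (simp add: walk_def)
    qed
    then show "G (Suc j) = Suc (G j) \<or> G j = Suc (G (Suc j))" "G j \<le> length p"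
      "?v ! j = p ! min (G j) (G (Suc j))" by blast+
  qed
  then show ?thesis by blast
qed

text \<open>If the walk does not turn inside the minimal Z-shape, the Z-shape survives in \<open>p\<close>. If it does, it
  can only turn at one of the two centres, since a turn is itself the centre of a palindrome of radius
  \<open>d\<close>; the walk is then symmetric there and \<open>2 * d\<close> letters can be skipped.\<close>

lemma walk_contract_minimal:
  assumes w: "walk u p F" and p: "Z_irreducible p"
    and Z: "Z_at u c d" and noZ: "\<And>c k. k < d \<Longrightarrow> \<not> Z_at u c k"
  shows "\<exists>G. walk (take c u @ drop (c + 2 * d) u) p G"
proof -
  have d: "0 < d" and p1: "pal u c d" and p2: "pal u (c + d) d" using Z by (auto simp: Z_at_def)
  note le = pal_le[OF p1] pal_le[OF p2]
  show ?thesis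
  proof (cases "\<exists>t. c - d < t \<and> t < c + 2 * d \<and> turn u F t")
    case True
    then obtain t where t: "c - d < t" "t < c + 2 * d" "turn u F t" by blast
    have sep: "\<And>t'. turn u F t' \<Longrightarrow> t' \<noteq> t \<Longrightarrow> t' + d \<le> t \<or> t + d \<le> t'"
      using turns_separated[OF w noZ] t by blast
    have pt: "pal u t d" by (rule isolated_turn_pal[OF w t(3) sep])
    \<comment> \<open>Two palindromes of radius \<open>d\<close> with distinct centres closer than
      \<open>d\<close> contain a Z-shape below the minimal size.\<close>
    have near: "t = x \<or> t + d \<le> x \<or> x + d \<le> t" if "pal u x d" for x
    proof (rule ccontr)
      assume A: "\<not> ?thesis"
      show False
      proof (cases "t < x")
        case True
        then have "Z_at u t (x - t)" using A by (intro Z_atI_pal[OF pt that]) auto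
        moreover have "x - t < d" using A True by linarith
        ultimately show False using noZ by blast
      next
        case False
        then have "Z_at u x (t - x)" using A by (intro Z_atI_pal[OF that pt]) auto
        moreover have "t - x < d" using A False by linarith
        ultimately show False using noZ by blast
      qed
    qed
    have tc: "t = c \<or> t = c + d" using near[OF p1] near[OF p2] t le d by auto
    have Ft: "F (t - d) = F (t + d)" using isolated_turn(3)[OF w t(3) sep] by blast
    from tc show ?thesis
    proof
      assume "t = c"
      have cd: "c - d + 2 * d = c + d" using le by simp
      have "\<exists>G. walk (take (c - d) u @ drop (c + d) u) p G"
        using walk_delete[OF w, of "c - d" "2 * d", unfolded cd] Ft le \<open>t = c\<close> by simp
      then show ?thesis using delete_shift[OF p1 p2] by simp
    next
      assume "t = c + d"
      then show ?thesis using walk_delete[OF w, of c "2 * d"] Ft le by (simp add: mult_2 add.assoc)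
    qed
  next
    case False
    define a where "a = c - d"
    have S: "(\<forall>i\<in>{a..c + 2 * d}. F i = F a + (i - a)) \<or> (\<forall>i\<in>{a..c + 2 * d}. F i + (i - a) = F a)"
      by (rule walk_straight[OF w]) (use False le in \<open>auto simp: a_def\<close>)
    have c: "c = a + d" using le by (simp add: a_def)
    have "\<exists>c' d'. Z_at p c' d'"
      using S
    proof
      assume A: "\<forall>i\<in>{a..c + 2 * d}. F i = F a + (i - a)"
      have F: "F (a + i) = F a + i" if "i \<le> 3 * d" for i
        using A[rule_format, of "a + i"] that c by simp
      have lb: "F a + 3 * d \<le> length p"
        using walk_le[OF w, of "a + 3 * d"] F[of "3 * d"] le c by simp
      have pn: "p ! (F a + i) = u ! (a + i)" if "i < 3 * d" for i
        using walk_nth[OF w, of "a + i"] F[of i] F[of "Suc i"] that le c by simp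
      have tr: "pal p (F a + k) d" if "pal u (a + k) d" "d \<le> k" "k + d \<le> 3 * d" for k
      proof (rule palI)
        fix i j assume ij: "i < F a + k" "F a + k \<le> j" "j < F a + k + d" "i + j + 1 = 2 * (F a + k)"
        then have ge: "F a \<le> i" using that by simp
        have "u ! (a + (i - F a)) = u ! (a + (j - F a))"
          by (rule pal_nth[OF that(1)]) (use ij ge in auto)
        then show "p ! i = p ! j"
          using pn[of "i - F a"] pn[of "j - F a"] ij ge that by simp
      qed (use that lb in auto)
      have "Z_at p (F a + d) d" unfolding Z_at_def
        using d tr[of d] tr[of "2 * d"] p1 p2 c by (simp add: mult_2 add.assoc)
      then show ?thesis by blast
    next
      assume A: "\<forall>i\<in>{a..c + 2 * d}. F i + (i - a) = F a"
      have F: "F (a + i) + i = F a" if "i \<le> 3 * d" for i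
        using A[rule_format, of "a + i"] that c by simp
      have lb: "3 * d \<le> F a" "F a \<le> length p"
        using walk_le[OF w, of a] F[of "3 * d"] le c by auto
      have pn: "p ! (F a - Suc i) = u ! (a + i)" if "i < 3 * d" for i
      proof -
        have "min (F (a + i)) (F (Suc (a + i))) = F a - Suc i"
          using F[of i] F[of "Suc i"] that by simp
        then show ?thesis using walk_nth[OF w, of "a + i"] that le c by simp
      qed
      have tr: "pal p (F a - k) d" if "pal u (a + k) d" "d \<le> k" "k + d \<le> 3 * d" for k
      proof (rule palI)
        fix i j assume ij: "i < F a - k" "F a - k \<le> j" "j < F a - k + d" "i + j + 1 = 2 * (F a - k)"
        then have ge: "j < F a" "F a - i \<le> 3 * d" using that lb by auto
        have "u ! (a + (F a - Suc j)) = u ! (a + (F a - Suc i))"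
          by (rule pal_nth[OF that(1)]) (use ij ge that lb in auto)
        then show "p ! i = p ! j"
          using pn[of "F a - Suc i"] pn[of "F a - Suc j"] ij ge that lb by simp
      qed (use that lb in auto)
      have "F a - 2 * d + d = F a - d" using lb by simp
      \<comment> \<open>A descending walk reads \<open>p\<close> backwards, so the second centre in
        \<open>u\<close> becomes the first centre in \<open>p\<close>.\<close>
      then have "Z_at p (F a - 2 * d) d" unfolding Z_at_def
        using d tr[of d] tr[of "2 * d"] p1 p2 c by (simp add: mult_2 add.assoc)
      then show ?thesis by blast
    qed
    then show ?thesis using p by (simp add: Z_irreducible_iff_Z_at)
  qed
qed

lemma Z_red_length: "u \<rightarrow>\<^sub>Z v \<Longrightarrow> length v < length u"
  by (auto simp: Z_red_def)

text \<open>A minimal Z-shape of \<open>u\<close> is chosen independently of \<open>p\<close> and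
  \<open>q\<close>, so contracting it gives one shorter string that still walks on both.\<close>

lemma walk_irreducible_unique:
  "walk u p F \<Longrightarrow> walk u q G \<Longrightarrow> Z_irreducible p \<Longrightarrow> Z_irreducible q \<Longrightarrow> p = q"
proof (induction "length u" arbitrary: u F G rule: less_induct)
  case less
  show ?case
  proof (cases "Z_irreducible u")
    case True
    then show ?thesis using walk_irreducible_eq less.prems by metis
  next
    case False
    define d where "d = (LEAST d. \<exists>c. Z_at u c d)"
    have "\<exists>d c. Z_at u c d" using False by (auto simp: Z_irreducible_iff_Z_at)
    then have "\<exists>c. Z_at u c d" unfolding d_def by (rule LeastI_ex)
    then obtain c where Z: "Z_at u c d" by blast
    have noZ: "\<not> Z_at u c k" if "k < d" for c k
      using not_less_Least[OF that[unfolded d_def]] by blast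
    let ?v = "take c u @ drop (c + 2 * d) u"
    have "length ?v < length u" using Z Z_red_length Z_red_iff_Z_at by blast
    moreover obtain F' where "walk ?v p F'"
      using walk_contract_minimal[OF less.prems(1,3) Z noZ] by blast
    moreover obtain G' where "walk ?v q G'"
      using walk_contract_minimal[OF less.prems(2,4) Z noZ] by blast
    ultimately show ?thesis using less.hyps less.prems(3,4) by blast
  qed
qed

lemma Z_reds_walk: "Z_red\<^sup>*\<^sup>* u p \<Longrightarrow> \<exists>F. walk u p F"
proof (induction rule: converse_rtranclp_induct)
  case base
  have "walk p p id" by (simp add: walk_def)
  then show ?case by blast
next
  case (step u v)
  then show ?case using walk_expand unfolding Z_red_iff_Z_at by blast
qed

lemma Z_nf_eqI:
  assumes "Z_red\<^sup>*\<^sup>* u v" "Z_irreducible v"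
  shows "Z_nf u = v"
  unfolding Z_nf_def
proof (rule the_equality)
  show "v' = v" if "Z_red\<^sup>*\<^sup>* u v' \<and> Z_irreducible v'" for v'
    using that assms Z_reds_walk walk_irreducible_unique by metis
qed (use assms in simp)


section \<open>Shortest even suffix palindromes\<close>

text \<open>Two palindromes that each reach the centre of the other contain a Z-shape.\<close>

lemma pal_spacing:
  assumes "Z_irreducible w" "pal w c r" "pal w c' r'" "c < c'"
  shows "r < c' - c \<or> r' < c' - c"
  using Z_atI_pal[OF assms(2,3,4)] assms(1) by (meson Z_irreducible_iff_Z_at not_less)

lemma Z_irreducible_take: "Z_irreducible w \<Longrightarrow> Z_irreducible (take l w)"
  unfolding Z_irreducible_iff_Z_at Z_at_def
  by (metis append_take_drop_id pal_append pal_le(2))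

text \<open>\<open>s l\<close> is the radius of the shortest nonempty even palindrome that is a suffix of the prefix of
  length \<open>l\<close>, and \<open>0\<close> if there is none.\<close>

definition suffix_radii :: "'a list \<Rightarrow> (nat \<Rightarrow> nat) \<Rightarrow> bool" where
  "suffix_radii w s \<longleftrightarrow> (\<forall>l\<le>length w. (0 < s l \<longrightarrow> pal w (l - s l) (s l)) \<and>
     (\<forall>e>0. pal w (l - e) e \<longrightarrow> 0 < s l \<and> s l \<le> e))"

lemma suffix_radii_pal: "suffix_radii w s \<Longrightarrow> l \<le> length w \<Longrightarrow> 0 < s l \<Longrightarrow> pal w (l - s l) (s l)"
  by (simp add: suffix_radii_def)

lemma suffix_radii_least:
  "suffix_radii w s \<Longrightarrow> l \<le> length w \<Longrightarrow> 0 < e \<Longrightarrow> pal w (l - e) e \<Longrightarrow> 0 < s l \<and> s l \<le> e"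
  by (simp add: suffix_radii_def)

lemma suffix_radii_le: "suffix_radii w s \<Longrightarrow> l \<le> length w \<Longrightarrow> 2 * s l \<le> l"
  using suffix_radii_pal[of w s l] pal_le(1)[of w "l - s l" "s l"] by (cases "s l = 0") auto

lemma suffix_radii_take:
  assumes "suffix_radii w s" "l \<le> length w"
  shows "suffix_radii (take l w) s"
  unfolding suffix_radii_def
proof (intro allI impI conjI)
  fix k assume k: "k \<le> length (take l w)"
  then have k': "k \<le> length w" "k \<le> l" by auto
  show "pal (take l w) (k - s k) (s k)" if "0 < s k"
    using suffix_radii_pal[OF assms(1) k'(1) that] suffix_radii_le[OF assms(1) k'(1)] k' assms(2)
    by (subst pal_take) auto
  fix e assume e: "0 < e" "pal (take l w) (k - e) e"
  then have "pal w (k - e) e"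
    using pal_append[of "k - e" e "take l w" "drop l w"] pal_le(2)[OF e(2)] by simp
  then show "0 < s k" "s k \<le> e" using suffix_radii_least[OF assms(1) k'(1) e(1)] by auto
qed

lemma suffix_radii_snoc:
  assumes s: "suffix_radii w s" and n: "n = Suc (length w)"
    and v1: "0 < v \<Longrightarrow> pal (w @ [a]) (n - v) v"
    and v2: "\<And>e. 0 < e \<Longrightarrow> pal (w @ [a]) (n - e) e \<Longrightarrow> 0 < v \<and> v \<le> e"
  shows "suffix_radii (w @ [a]) (s(n := v))"
  unfolding suffix_radii_def
proof (intro allI)
  fix l
  show "l \<le> length (w @ [a]) \<longrightarrow>
         (0 < (s(n := v)) l \<longrightarrow> pal (w @ [a]) (l - (s(n := v)) l) ((s(n := v)) l)) \<and>
         (\<forall>e>0. pal (w @ [a]) (l - e) e \<longrightarrow> 0 < (s(n := v)) l \<and> (s(n := v)) l \<le> e)"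
  proof (cases "l \<le> length w")
    case True
    then have "l \<noteq> n" using n by simp
    have "pal (w @ [a]) (l - s l) (s l)" if "0 < s l"
      using suffix_radii_pal[OF s True that] suffix_radii_le[OF s True] True
      by (subst pal_append) auto
    moreover have "0 < s l \<and> s l \<le> e" if "0 < e" "pal (w @ [a]) (l - e) e" for e
    proof -
      have "e \<le> l - e" using pal_le(1)[OF that(2)] .
      then have "pal w (l - e) e" using that True by (subst (asm) pal_append) auto
      then show ?thesis using suffix_radii_least[OF s True that(1)] by blast
    qed
    ultimately show ?thesis using \<open>l \<noteq> n\<close> by simp
  next
    case False
    then have "l = n" if "l \<le> length (w @ [a])" using that n by simp
    then show ?thesis using v1 v2 by auto
  qed
qed

text \<open>In a Z-shape \<open>y @ rev y @ y\<close> completed by the last letter, a shorter even suffix palindrome of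
  \<open>rev y @ y\<close> or of \<open>y @ rev y\<close> would produce a Z-shape already before that letter. So looking at the
  shortest suffix palindromes is enough.\<close>

lemma snoc_Z_irreducible_iff:
  assumes irr: "Z_irreducible w" and s: "suffix_radii (w @ [a]) s" and n: "n = Suc (length w)"
  shows "Z_irreducible (w @ [a]) \<longleftrightarrow> \<not> (0 < s n \<and> s (n - s n) = s n)"
proof -
  let ?w = "w @ [a]"
  have ln: "n = length ?w" using n by simp
  have noZ: "\<not> Z_at w c d" for c d using irr by (simp add: Z_irreducible_iff_Z_at)
  have down: "pal w c r" if "pal ?w c r" "c + r < n" for c r
    using that n pal_append[of c r w "[a]"] by simp
  have sp: "r < c' - c \<or> r' < c' - c" if "pal ?w c r" "pal ?w c' r'" "c < c'" "c + r < n" "c' + r' < n" for c c' r r'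
    using pal_spacing[OF irr down down that(3)] that by blast
  show ?thesis
  proof
    assume irr': "Z_irreducible ?w"
    show "\<not> (0 < s n \<and> s (n - s n) = s n)"
    proof
      let ?d = "s n"
      assume A: "0 < ?d \<and> s (n - ?d) = ?d"
      have p1: "pal ?w (n - ?d) ?d" using suffix_radii_pal[OF s, of n] A ln by simp
      moreover have "n - ?d \<le> length ?w" using ln by simp
      then have p2: "pal ?w (n - ?d - ?d) ?d" using suffix_radii_pal[OF s, of "n - ?d"] A by simp
      moreover have "n - ?d - ?d + ?d = n - ?d" using pal_le[OF p1] by simp
      ultimately have "Z_at ?w (n - ?d - ?d) ?d" using A by (simp add: Z_at_def)
      then show False using irr' by (auto simp: Z_irreducible_iff_Z_at)
    qed
  next
    assume A: "\<not> (0 < s n \<and> s (n - s n) = s n)"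
    show "Z_irreducible ?w"
    proof (rule ccontr)
      assume "\<not> Z_irreducible ?w"
      then obtain c d where Z: "Z_at ?w c d" by (auto simp: Z_irreducible_iff_Z_at)
      then have d: "0 < d" and p1: "pal ?w c d" and p2: "pal ?w (c + d) d" by (auto simp: Z_at_def)
      note le = pal_le[OF p1] pal_le[OF p2]
      have nd: "n = c + 2 * d"
      proof (rule ccontr)
        assume "n \<noteq> c + 2 * d"
        then have "c + d + d < n" using le n by simp
        then have "Z_at w c d" using down[OF p1] down[OF p2] d by (simp add: Z_at_def)
        then show False using noZ by blast
      qed
      \<comment> \<open>One letter shorter, the palindrome lies inside \<open>w\<close>, where
        irreducibility applies.\<close>
      have p2': "pal ?w (c + d) (d - 1)" using pal_mono[OF p2] by simp
      have sn: "s n = d"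
      proof (rule ccontr)
        assume "s n \<noteq> d"
        have "n - d = c + d" using nd by simp
        then have "0 < s n \<and> s n \<le> d" using suffix_radii_least[OF s, of n d] p2 d ln by simp
        with \<open>s n \<noteq> d\<close> have e: "0 < s n" "s n < d" by auto
        define e where "e = s n"
        have pe: "pal ?w (n - e) e" using suffix_radii_pal[OF s, of n] e ln by (simp add: e_def)
        have pe': "pal ?w (n - e) (e - 1)" using pal_mono[OF pe] by simp
        show False
        proof (cases "2 * e \<le> d")
          case True
          \<comment> \<open>The suffix palindrome centred at \<open>n - e\<close>, mirrored about
            \<open>c + d\<close>, has centre \<open>c + e\<close>. With the palindrome around
            \<open>c\<close> it gives a Z-shape inside \<open>w\<close>.\<close>
          have pm: "pal ?w (c + e) e"
          proof (rule palI)
            fix i j assume ij: "i < c + e" "c + e \<le> j" "j < c + e + e" "i + j + 1 = 2 * (c + e)"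
            let ?m = "\<lambda>i. 2 * (c + d) - Suc i"
            have "?w ! i = ?w ! ?m i" using ij nd True by (intro pal_nth[OF p2]) auto
            also have "\<dots> = ?w ! ?m j" using ij nd True e by (intro pal_nth[OF pe]) (auto simp: e_def)
            also have "\<dots> = ?w ! j" using ij nd True by (intro pal_nth[OF p2]) auto
            finally show "?w ! i = ?w ! j" .
          qed (use nd ln True in auto)
          have "e < c + e - c \<or> d < c + e - c" using sp[OF p1 pm] pal_mono[OF p1, of e]
              sp[of c e "c + e" e] pm nd True e by (auto simp: e_def)
          then show False using e by (auto simp: e_def)
        next
          case False
          \<comment> \<open>The centres are \<open>d - e\<close> apart, which is at most both
            shortened radii because \<open>d < 2 * e\<close> and \<open>0 < e\<close>.\<close>
          then have "d - 1 < (n - e) - (c + d) \<or> e - 1 < (n - e) - (c + d)"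
            using e nd by (intro sp[OF p2' pe']) (auto simp: e_def)
          then show False using False e nd by (auto simp: e_def)
        qed
      qed
      have "s (c + d) = d"
      proof (rule ccontr)
        assume ne: "s (c + d) \<noteq> d"
        have cdl: "c + d \<le> length ?w" using le by simp
        have "0 < s (c + d) \<and> s (c + d) \<le> d" using suffix_radii_least[OF s cdl d] p1 by simp
        with ne have e: "0 < s (c + d)" "s (c + d) < d" by auto
        define e where "e = s (c + d)"
        have pe: "pal ?w (c + d - e) e" using suffix_radii_pal[OF s cdl e(1)] by (simp add: e_def)
        have "e < (c + d) - (c + d - e) \<or> d - 1 < (c + d) - (c + d - e)"
          using e nd le by (intro sp[OF pe p2']) (auto simp: e_def)
        then show False using e by (auto simp: e_def)
      qed
      moreover have "n - d = c + d" using nd by simp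
      ultimately show False using A sn d by simp
    qed
  qed
qed

lemma shortest_Z_reduce:
  assumes s: "suffix_radii w s" and n: "n = length w" and "0 < s n" "s (n - s n) = s n"
  shows "w \<rightarrow>\<^sub>Z take (n - 2 * s n) w" and "2 * s n \<le> n"
proof -
  let ?d = "s n" let ?c = "n - 2 * s n"
  have p1: "pal w (n - ?d) ?d" using suffix_radii_pal[OF s, of n] assms by simp
  moreover have "n - ?d \<le> length w" using n by simp
  then have p2: "pal w (n - ?d - ?d) ?d" using suffix_radii_pal[OF s, of "n - ?d"] assms by simp
  show le: "2 * s n \<le> n" using pal_le[OF p1] by simp
  have eq: "n - ?d - ?d = ?c" "?c + ?d = n - ?d" using le by auto
  have "Z_at w ?c ?d" using p1 p2 assms unfolding Z_at_def eq by simp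
  moreover have "take ?c w = take ?c w @ drop (?c + 2 * ?d) w" using le n by simp
  ultimately show "w \<rightarrow>\<^sub>Z take ?c w" unfolding Z_red_iff_Z_at by blast
qed

section \<open>Finding the next shortest suffix palindrome\<close>

text \<open>The chain of level \<open>n\<close> starts with \<open>n\<close> itself, the centre of the empty palindrome. It contains the
  centres of all even suffix palindromes of level \<open>n\<close>, but also centres whose palindrome has ended
  before \<open>n\<close> unnoticed: an element is only known to reach as far as its predecessor in the chain.\<close>

function chain :: "(nat \<Rightarrow> nat) \<Rightarrow> nat \<Rightarrow> nat list" where
  "chain s n = n # (if s n = 0 \<or> n = 0 then [] else chain s (n - s n))"
  by auto
termination by (relation "measure snd") auto

declare chain.simps [simp del]

lemma chain_cong: "(\<And>i. i \<le> n \<Longrightarrow> s i = t i) \<Longrightarrow> chain s n = chain t n"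
proof (induction n rule: less_induct)
  case (less n)
  show ?case
  proof (cases "s n = 0 \<or> n = 0")
    case False
    then have "chain s (n - s n) = chain t (n - s n)" using less by simp
    then show ?thesis using less.prems[of n] by (simp add: chain.simps[of _ n])
  qed (use less.prems[of n] in \<open>auto simp: chain.simps[of _ n]\<close>)
qed

lemma chain_le: "c \<in> set (chain s n) \<Longrightarrow> c \<le> n"
  by (induction s n rule: chain.induct) (subst (asm) (2) chain.simps, force split: if_splits)

lemma chain_self: "n \<in> set (chain s n)"
  by (subst chain.simps) simp

lemma chain_trans: "c \<in> set (chain s n) \<Longrightarrow> set (chain s c) \<subseteq> set (chain s n)"
proof (induction s n rule: chain.induct)
  case (1 s n)
  show ?case
  proof (cases "c = n")
    case False
    then have "\<not> (s n = 0 \<or> n = 0)" "c \<in> set (chain s (n - s n))"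
      using "1.prems" by (subst (asm) chain.simps, auto split: if_splits)+
    then show ?thesis using "1.IH" by (subst (2) chain.simps) auto
  qed simp
qed

lemma chain_linear: "c \<in> set (chain s n) \<Longrightarrow> x \<in> set (chain s n) \<Longrightarrow> x \<le> c \<Longrightarrow> x \<in> set (chain s c)"
proof (induction s n rule: chain.induct)
  case (1 s n)
  show ?case
  proof (cases "c = n")
    case True
    then show ?thesis using 1 by simp
  next
    case False
    then have *: "\<not> (s n = 0 \<or> n = 0)" "c \<in> set (chain s (n - s n))"
      using "1.prems"(1) by (subst (asm) chain.simps, auto split: if_splits)+
    then have "x \<noteq> n" using chain_le[OF *(2)] "1.prems"(3) by auto
    then have "x \<in> set (chain s (n - s n))"
      using "1.prems"(2) by (subst (asm) chain.simps, auto split: if_splits)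
    then show ?thesis using "1.IH" * "1.prems" by blast
  qed
qed

lemma chain_less: "x \<in> set (chain s c) \<Longrightarrow> x < c \<Longrightarrow> 0 < s c \<and> x \<in> set (chain s (c - s c)) \<and> x \<le> c - s c"
  by (subst (asm) chain.simps) (auto split: if_splits dest: chain_le)

lemma chain_step: "0 < s c \<Longrightarrow> 0 < c \<Longrightarrow> chain s c = c # chain s (c - s c)"
  by (subst chain.simps) simp

text \<open>If \<open>c < l\<close>, the shortest suffix palindrome at \<open>l\<close> is no longer
  than the one around \<open>c\<close>. Hence its centre \<open>l - s l\<close> is at least
  \<open>c\<close>, and the palindrome around \<open>c\<close> also reaches that level.\<close>

lemma alive_in_chain:
  assumes s: "suffix_radii w s"
  shows "l \<le> length w \<Longrightarrow> c \<le> l \<Longrightarrow> pal w c (l - c) \<Longrightarrow> c \<in> set (chain s l)"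
proof (induction l rule: less_induct)
  case (less l)
  show ?case
  proof (cases "c = l")
    case True
    then show ?thesis by (simp add: chain_self)
  next
    case False
    then have "0 < s l \<and> s l \<le> l - c"
      using suffix_radii_least[OF s less.prems(1), of "l - c"] less.prems by simp
    moreover from this have "c \<in> set (chain s (l - s l))"
      using less.prems False by (intro less.IH) (auto intro: pal_mono)
    ultimately show ?thesis using chain_step[of s l] less.prems by auto
  qed
qed

text \<open>Extending the string only removes old elements from the chain. If \<open>l\<close> lies
  strictly between \<open>n - s n\<close> and \<open>n\<close>, the palindrome around
  \<open>n - s n\<close> reaches \<open>l\<close>, so that centre is in the chain of
  \<open>l\<close>.\<close>

lemma chain_prefix:
  assumes s: "suffix_radii w s"
  shows "n \<le> length w \<Longrightarrow> x \<in> set (chain s n) \<Longrightarrow> x \<le> l \<Longrightarrow> l \<le> n \<Longrightarrow> x \<in> set (chain s l)"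
proof (induction n rule: less_induct)
  case (less n)
  show ?case
  proof (cases "x = n \<or> l = n")
    case True
    then show ?thesis using less.prems chain_self by auto
  next
    case False
    then have x: "0 < s n" "x \<in> set (chain s (n - s n))" "0 < n"
      using chain_less[OF less.prems(2)] less.prems by auto
    show ?thesis
    proof (cases "l \<le> n - s n")
      case True
      then show ?thesis using less.IH[of "n - s n"] less.prems x by simp
    next
      case F: False
      have "pal w (n - s n) (l - (n - s n))"
        using suffix_radii_pal[OF s less.prems(1) x(1)] less.prems(4) by (auto elim: pal_mono)
      then have "n - s n \<in> set (chain s l)"
        using F less.prems by (intro alive_in_chain[OF s]) auto
      then show ?thesis using chain_trans x(2) by blast
    qed
  qed
qed

section \<open>Maximal radii and mirroring\<close>

definition max_radius :: "'a list \<Rightarrow> nat \<Rightarrow> nat \<Rightarrow> bool" where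
  "max_radius u c k \<longleftrightarrow> pal u c k \<and> \<not> pal u c (Suc k)"

lemma max_radius_ge: "max_radius u c k \<Longrightarrow> pal u c j \<Longrightarrow> j \<le> k"
  unfolding max_radius_def by (meson not_less_eq_eq pal_mono)

lemma max_radius_mismatch:
  assumes "max_radius u c k" "k < c" "c + k < length u" "i + j + 1 = 2 * c" "j = c + k"
  shows "u ! i \<noteq> u ! j"
proof
  assume eq: "u ! i = u ! j"
  have "pal u c (Suc k)"
  proof (rule palI)
    fix i' j' assume ij: "i' < c" "c \<le> j'" "j' < c + Suc k" "i' + j' + 1 = 2 * c"
    show "u ! i' = u ! j'"
    proof (cases "j' = j")
      case True
      then have "i' = i" using ij assms by simp
      then show ?thesis using True eq by simp
    next
      case False
      then show ?thesis using assms(1,5) ij by (intro pal_nth[of u c k]) (auto simp: max_radius_def)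
    qed
  qed (use assms in auto)
  then show False using assms(1) by (simp add: max_radius_def)
qed

text \<open>Manacher's observation: inside the palindrome of radius \<open>d\<close> around \<open>c\<close>, the palindromes
  around \<open>c + d\<close> and \<open>c - d\<close> mirror each other as long as both exist.\<close>

lemma mirror_extend:
  assumes c: "pal u c d" and g: "pal u (c + d) k" and m: "pal u (c - d) k" and k: "k < d"
  shows "pal u c (d + k)"
proof (rule palI)
  note le = pal_le[OF c] pal_le[OF g] pal_le[OF m]
  show "d + k \<le> c" "c + (d + k) \<le> length u" using le by auto
  fix i j assume ij: "i < c" "c \<le> j" "j < c + (d + k)" "i + j + 1 = 2 * c"
  show "u ! i = u ! j"
  proof (cases "j < c + d")
    case True
    then show ?thesis using ij by (intro pal_nth[OF c]) auto
  next
    case False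
    have "u ! i = u ! (2 * (c - d) - Suc i)" using ij False le k by (intro pal_nth[OF m]) auto
    also have "\<dots> = u ! (2 * (c + d) - Suc j)" using ij False le k by (intro pal_nth[OF c]) auto
    also have "\<dots> = u ! j" using ij False le k by (intro pal_nth[OF g]) auto
    finally show ?thesis .
  qed
qed

text \<open>If the palindrome around \<open>c\<close> extended one letter further, the side
  palindromes would agree on the next pair of letters, yet exactly one of them fails there. The
  bound \<open>k < d\<close> keeps the inner letters inside the known palindrome.\<close>

lemma mirror_max_radius:
  assumes c: "pal u c d" and g: "max_radius u (c + d) k" and m: "max_radius u (c - d) k'"
    and k: "k < d" and ne: "k \<noteq> k'"
  shows "max_radius u c (d + min k k')"
proof -
  define q where "q = min k k'"
  have pg: "pal u (c + d) k" and pm: "pal u (c - d) k'" using g m by (auto simp: max_radius_def)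
  note le = pal_le[OF c] pal_le[OF pg] pal_le[OF pm]
  have q: "q < d" using k by (simp add: q_def)
  have "pal u c (d + q)"
    using pal_mono[OF pg, of q] pal_mono[OF pm, of q] q by (intro mirror_extend[OF c]) (auto simp: q_def)
  moreover have "\<not> pal u c (Suc (d + q))"
  proof
    assume P: "pal u c (Suc (d + q))"
    note leP = pal_le[OF P]
    define i where "i = c - d - Suc q"
    define j where "j = c + d + q"
    have eq: "u ! i = u ! j" using leP by (intro pal_nth[OF P]) (auto simp: i_def j_def)
    have mid: "u ! (c - d + q) = u ! (c + d - Suc q)" using q le by (intro pal_nth[OF c]) auto
    show False
    proof (cases "k' < k")
      case True
      then have qk: "q = k'" by (simp add: q_def)
      have "u ! i \<noteq> u ! (c - d + q)"
        using leP by (intro max_radius_mismatch[OF m]) (auto simp: qk i_def)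
      moreover have "u ! (c + d - Suc q) = u ! j"
        using True leP q by (intro pal_nth[OF pg]) (auto simp: qk j_def)
      ultimately show False using eq mid by simp
    next
      case False
      then have qk: "q = k" "k < k'" using ne by (auto simp: q_def)
      have "u ! (c + d - Suc q) \<noteq> u ! j"
        using leP q by (intro max_radius_mismatch[OF g]) (auto simp: qk j_def)
      moreover have "u ! i = u ! (c - d + q)"
        using qk leP q by (intro pal_nth[OF pm]) (auto simp: i_def)
      ultimately show False using eq mid by simp
    qed
  qed
  ultimately show ?thesis by (simp add: max_radius_def q_def)
qed

definition radii :: "'a list \<Rightarrow> (nat \<Rightarrow> nat) \<Rightarrow> (nat \<Rightarrow> nat) \<Rightarrow> bool" where
  "radii w s r \<longleftrightarrow> (\<forall>x\<le>length w. x \<notin> set (chain s (length w)) \<longrightarrow> max_radius w x (r x))"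

text \<open>A centre outside the chain of \<open>l\<close> does not reach \<open>l\<close>, so
  truncation keeps its radius. Popping therefore needs no update of the array.\<close>

lemma radii_take:
  assumes s: "suffix_radii w s" and r: "radii w s r" and l: "l \<le> length w"
  shows "radii (take l w) s r"
  unfolding radii_def
proof (intro allI impI)
  fix x assume "x \<le> length (take l w)" and "x \<notin> set (chain s (length (take l w)))"
  then have x: "x \<le> l" "x \<notin> set (chain s l)" using l by (auto simp: min_absorb2)
  then have "x \<notin> set (chain s (length w))" using chain_prefix[OF s _ _ x(1) l] by auto
  then have m: "max_radius w x (r x)" using r x l by (simp add: radii_def)
  have "\<not> pal w x (l - x)" using x alive_in_chain[OF s l x(1)] by blast
  then have "r x < l - x" using m pal_mono by (meson max_radius_def not_le)
  then show "max_radius (take l w) x (r x)" using m l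
    by (simp add: max_radius_def pal_take)
qed

text \<open>
  State of the search for the largest centre in the chain whose palindrome extends by the new letter
  \<open>a\<close>, with current candidate \<open>c\<close>. The stack \<open>st\<close> holds rejected centres such that each palindrome
  reaches at least to the element below it, the bottom one reaching to the end of \<open>w\<close>. The candidate
  is known to reach the top element and is compared with it by mirroring; a top element that
  it outlives is of no further use.
\<close>

definition search_inv ::
    "'a list \<Rightarrow> 'a \<Rightarrow> (nat \<Rightarrow> nat) \<Rightarrow> (nat \<Rightarrow> nat) \<Rightarrow> (nat \<Rightarrow> nat) \<Rightarrow> nat \<Rightarrow> nat \<Rightarrow> bool" where
  "search_inv w a s r st p c \<longleftrightarrow>
     c \<in> set (chain s (length w)) \<and> st 0 = length w \<and>
     (\<forall>x. c < x \<longrightarrow> x \<le> length w \<longrightarrow> \<not> pal (w @ [a]) x (Suc (length w) - x)) \<and>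
     (\<forall>x\<le>length w. x \<notin> set (chain s c) \<longrightarrow> max_radius (w @ [a]) x (r x)) \<and>
     pal w c (st p - c) \<and>
     (\<forall>i. 1 \<le> i \<longrightarrow> i \<le> p \<longrightarrow> c < st i \<and> st i \<le> length w \<and> st (i - 1) \<le> st i + r (st i)) \<and>
     p + c \<le> length w"

lemma search_inv_init:
  assumes s: "suffix_radii w s" and r: "radii w s r" and st: "st 0 = length w"
  shows "search_inv w a s r st 0 (length w)"
proof -
  have "max_radius (w @ [a]) x (r x)" if x: "x \<le> length w" "x \<notin> set (chain s (length w))" for x
  proof -
    have m: "max_radius w x (r x)" using r x by (simp add: radii_def)
    have "\<not> pal w x (length w - x)" using x alive_in_chain[OF s _ x(1)] by blast
    then have "r x < length w - x" using m pal_mono by (meson max_radius_def not_le)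
    then show ?thesis using m by (simp add: max_radius_def pal_append)
  qed
  then show ?thesis using st by (simp add: search_inv_def chain_self pal_0)
qed

section \<open>One step of the search\<close>

context
  fixes w :: "'a list" and a :: 'a and s r st :: "nat \<Rightarrow> nat" and p c :: nat
  assumes irr: "Z_irreducible w" and s: "suffix_radii w s"
    and inv: "search_inv w a s r st p c"
begin

lemma search_facts:
  shows "c \<in> set (chain s (length w))" "st 0 = length w" "c \<le> length w" "p + c \<le> length w"
    "\<And>x. c < x \<Longrightarrow> x \<le> length w \<Longrightarrow> \<not> pal (w @ [a]) x (Suc (length w) - x)"
    "\<And>x. x \<le> length w \<Longrightarrow> x \<notin> set (chain s c) \<Longrightarrow> max_radius (w @ [a]) x (r x)"
    "pal w c (st p - c)"
    "\<And>i. 1 \<le> i \<Longrightarrow> i \<le> p \<Longrightarrow> c < st i \<and> st i \<le> length w \<and> st (i - 1) \<le> st i + r (st i)"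
  using inv by (auto simp: search_inv_def)

lemma search_top:
  assumes p: "1 \<le> p"
  defines "g \<equiv> st p"
  shows "c < g" "g \<le> length w" "g - c \<le> c" "max_radius (w @ [a]) g (r g)"
    "max_radius (w @ [a]) (2 * c - g) (r (2 * c - g))" "r g < g - c" "g + r g \<le> length w"
proof -
  show g: "c < g" "g \<le> length w" using search_facts(8)[OF p order_refl] by (auto simp: g_def)
  have pc: "pal w c (g - c)" using search_facts(7) by (simp add: g_def)
  show le: "g - c \<le> c" using pal_le[OF pc] by simp
  have "g \<notin> set (chain s c)" using chain_le g by fastforce
  then show mg: "max_radius (w @ [a]) g (r g)" using search_facts(6) g by simp
  \<comment> \<open>A mirror image in the chain would put \<open>c - s c\<close> so close to
    \<open>c\<close> that the two palindromes form a Z-shape.\<close>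
  have "2 * c - g \<notin> set (chain s c)"
  proof
    assume "2 * c - g \<in> set (chain s c)"
    moreover have "2 * c - g < c" using g le by simp
    ultimately have sc: "0 < s c" "2 * c - g \<le> c - s c" using chain_less by blast+
    have "pal w (c - s c) (s c)" using suffix_radii_pal[OF s search_facts(3) sc(1)] .
    then have "s c < c - (c - s c) \<or> g - c < c - (c - s c)"
      using pc sc g le by (intro pal_spacing[OF irr]) auto
    then show False using sc g le by auto
  qed
  then show "max_radius (w @ [a]) (2 * c - g) (r (2 * c - g))"
    using search_facts(6) search_facts(3) g by simp
  have pg: "pal (w @ [a]) g (r g)" using mg by (simp add: max_radius_def)
  show gr: "g + r g \<le> length w"
  proof (rule ccontr)
    assume "\<not> g + r g \<le> length w"
    then have "pal (w @ [a]) g (Suc (length w) - g)" using pal_mono[OF pg] by simp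
    then show False using search_facts(5) g by blast
  qed
  then have "pal w g (r g)" using pg by (simp add: pal_append)
  then show "r g < g - c" using pal_spacing[OF irr pc _ g(1)] by blast
qed

text \<open>Equal radii let the palindrome around \<open>c\<close> extend by mirroring to the end of
  the palindrome around the top, hence to the next stack element.\<close>

lemma search_pop:
  assumes p: "1 \<le> p" and eq: "r (st p) = r (2 * c - st p)"
  shows "search_inv w a s r st (p - 1) c"
proof -
  let ?g = "st p"
  note t = search_top[OF p]
  have cg: "c + (?g - c) = ?g" "c - (?g - c) = 2 * c - ?g" using t by auto
  have pc: "pal (w @ [a]) c (?g - c)" using search_facts(7) t by (simp add: pal_append)
  have "pal (w @ [a]) c (?g - c + r ?g)"
    using t eq by (intro mirror_extend[OF pc]) (auto simp: cg max_radius_def)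
  then have "pal w c (?g - c + r ?g)" using t by (subst (asm) pal_append) auto
  then have "pal w c (st (p - 1) - c)"
    using search_facts(8)[OF p order_refl] by (auto elim: pal_mono)
  then show ?thesis using inv p by (auto simp: search_inv_def)
qed

text \<open>Unequal radii determine the radius of the candidate without any comparison of
  letters.\<close>

lemma search_radius:
  assumes p: "1 \<le> p" and ne: "r (st p) \<noteq> r (2 * c - st p)"
  defines "k \<equiv> st p - c + min (r (st p)) (r (2 * c - st p))"
  shows "max_radius (w @ [a]) c k" "st p - c \<le> k" "k \<le> length w - c"
proof -
  let ?g = "st p"
  note t = search_top[OF p]
  have cg: "c + (?g - c) = ?g" "c - (?g - c) = 2 * c - ?g" using t by auto
  have pc: "pal (w @ [a]) c (?g - c)" using search_facts(7) t by (simp add: pal_append)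
  show "max_radius (w @ [a]) c k"
    unfolding k_def using t ne by (intro mirror_max_radius[OF pc]) (auto simp: cg)
  show "st p - c \<le> k" "k \<le> length w - c" using t by (auto simp: k_def)
qed

text \<open>With an empty stack \<open>c\<close> is known to reach the end of \<open>w\<close>, so
  one comparison decides. The index \<open>n\<close> is mirrored to \<open>2 * c - (n + 1)\<close>,
  provided that this position exists.\<close>

lemma search_letter:
  assumes "p = 0"
  defines "n \<equiv> length w"
  shows "n + 1 \<le> 2 * c \<Longrightarrow> (w @ [a]) ! n = (w @ [a]) ! (2 * c - (n + 1)) \<Longrightarrow> pal (w @ [a]) c (Suc n - c)"
    and "\<not> (n + 1 \<le> 2 * c \<and> (w @ [a]) ! n = (w @ [a]) ! (2 * c - (n + 1))) \<Longrightarrow> max_radius (w @ [a]) c (n - c)"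
proof -
  have cn: "c \<le> n" using search_facts(3) by (simp add: n_def)
  have pc: "pal w c (n - c)" using search_facts(2,7) assms(1) by (simp add: n_def)
  then have pc': "pal (w @ [a]) c (n - c)" using cn by (simp add: pal_append n_def)
  show "pal (w @ [a]) c (Suc n - c)" if "n + 1 \<le> 2 * c" "(w @ [a]) ! n = (w @ [a]) ! (2 * c - (n + 1))"
  proof (rule palI)
    fix i j assume ij: "i < c" "c \<le> j" "j < c + (Suc n - c)" "i + j + 1 = 2 * c"
    show "(w @ [a]) ! i = (w @ [a]) ! j"
    proof (cases "j = n")
      case True
      then have "i = 2 * c - (n + 1)" using ij by simp
      then show ?thesis using that True by simp
    next
      case False
      then show ?thesis using ij cn by (intro pal_nth[OF pc']) auto
    qed
  qed (use that cn in \<open>auto simp: n_def\<close>)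
  assume A: "\<not> (n + 1 \<le> 2 * c \<and> (w @ [a]) ! n = (w @ [a]) ! (2 * c - (n + 1)))"
  have "\<not> pal (w @ [a]) c (Suc (n - c))"
  proof
    assume P: "pal (w @ [a]) c (Suc (n - c))"
    then have "n + 1 \<le> 2 * c" using pal_le[OF P] cn by simp
    moreover have "(w @ [a]) ! n = (w @ [a]) ! (2 * c - (n + 1))"
      using pal_le[OF P] cn by (intro pal_nth[OF P]) auto
    ultimately show False using A by blast
  qed
  then show "max_radius (w @ [a]) c (n - c)" using pc' by (simp add: max_radius_def)
qed

text \<open>A centre that accepts the new letter already reached the end of \<open>w\<close>, so it
  lies in the chain. Hence moving on to \<open>c - s c\<close> skips no viable centre.\<close>

lemma dead_below:
  assumes "x < c" "pal (w @ [a]) x (Suc (length w) - x)"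
  shows "0 < s c \<and> x \<le> c - s c"
proof -
  have "pal w x (length w - x)"
    using pal_mono[OF assms(2), of "length w - x"] assms(1) search_facts(3) by (simp add: pal_append)
  then have "x \<in> set (chain s (length w))"
    using alive_in_chain[OF s] assms(1) search_facts(3) by simp
  then have "x \<in> set (chain s c)" using chain_linear[OF search_facts(1)] assms(1) by simp
  then show ?thesis using chain_less assms(1) by blast
qed

lemma search_next:
  assumes k: "max_radius (w @ [a]) c k" "st p - c \<le> k" "k \<le> length w - c" and sc: "0 < s c"
  shows "search_inv w a s (r(c := k)) (st(Suc p := c)) (Suc p) (c - s c)"
proof -
  have c: "c \<le> length w" using search_facts(3) .
  have s2: "2 * s c \<le> c" using suffix_radii_le[OF s c] .
  have c0: "0 < c" "c - s c < c" using s2 sc by auto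
  have ch: "chain s c = c # chain s (c - s c)" using chain_step[of s c] sc c0(1) by blast
  have "c - s c \<in> set (chain s (length w))"
    using chain_trans[OF search_facts(1)] ch chain_self[of "c - s c" s] by auto
  moreover have "\<not> pal (w @ [a]) x (Suc (length w) - x)" if "c - s c < x" "x \<le> length w" for x
  proof
    assume P: "pal (w @ [a]) x (Suc (length w) - x)"
    consider "c < x" | "x = c" | "x < c" by linarith
    then show False
    proof cases
      case 1
      then show ?thesis using search_facts(5) that P by blast
    next
      case 2
      then show ?thesis using max_radius_ge[OF k(1)] P k(3) c by fastforce
    next
      case 3
      then show ?thesis using dead_below P that by fastforce
    qed
  qed
  moreover have "max_radius (w @ [a]) x ((r(c := k)) x)" if "x \<le> length w" "x \<notin> set (chain s (c - s c))" for x
    using that k(1) ch search_facts(6) by auto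
  moreover have "pal w (c - s c) ((st(Suc p := c)) (Suc p) - (c - s c))"
    using suffix_radii_pal[OF s c sc] s2 by simp
  moreover have "c - s c < (st(Suc p := c)) i \<and> (st(Suc p := c)) i \<le> length w \<and>
      (st(Suc p := c)) (i - 1) \<le> (st(Suc p := c)) i + (r(c := k)) ((st(Suc p := c)) i)"
    if i: "1 \<le> i" "i \<le> Suc p" for i
  proof (cases "i = Suc p")
    case True
    then show ?thesis using c0 c k(2) by auto
  next
    case False
    then have "i \<le> p" using i by simp
    then show ?thesis using search_facts(8)[OF i(1)] i c0 by auto
  qed
  \<comment> \<open>The push raises \<open>p\<close> by one while the candidate drops by at least
    one.\<close>
  moreover have "Suc p + (c - s c) \<le> length w" using search_facts(4) sc s2 by simp
  ultimately show ?thesis using search_facts(2) unfolding search_inv_def by simp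
qed

text \<open>Candidates are tried from the right, so the first one that extends is the centre of the
  shortest suffix palindrome.\<close>

lemma search_found:
  assumes P: "pal (w @ [a]) c (Suc (length w) - c)"
  defines "s' \<equiv> s(Suc (length w) := Suc (length w) - c)"
  shows "suffix_radii (w @ [a]) s'" "radii (w @ [a]) s' r"
    "chain s' (Suc (length w)) = Suc (length w) # chain s c"
proof -
  let ?n = "length w"
  have c: "c \<le> ?n" using search_facts(3) .
  show "suffix_radii (w @ [a]) s'" unfolding s'_def
  proof (rule suffix_radii_snoc[OF s refl])
    show "pal (w @ [a]) (Suc ?n - (Suc ?n - c)) (Suc ?n - c)" using P c by simp
    fix e assume e: "0 < e" "pal (w @ [a]) (Suc ?n - e) e"
    have "Suc ?n - e \<le> ?n" "Suc ?n - (Suc ?n - e) = e" using e pal_le[OF e(2)] by auto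
    then have "\<not> c < Suc ?n - e" using search_facts(5)[of "Suc ?n - e"] e by auto
    then show "0 < Suc ?n - c \<and> Suc ?n - c \<le> e" using c by auto
  qed
  have "chain s' c = chain s c" by (rule chain_cong) (use c in \<open>auto simp: s'_def\<close>)
  then show ch: "chain s' (Suc ?n) = Suc ?n # chain s c"
    using chain_step[of s' "Suc ?n"] c by (simp add: s'_def)
  show "radii (w @ [a]) s' r"
    using search_facts(6) ch by (auto simp: radii_def le_Suc_eq)
qed

lemma search_exhausted:
  assumes k: "max_radius (w @ [a]) c k" "k \<le> length w - c" and sc: "s c = 0"
  defines "s' \<equiv> s(Suc (length w) := 0)"
  shows "suffix_radii (w @ [a]) s'" "radii (w @ [a]) s' (r(c := k))"
    "chain s' (Suc (length w)) = [Suc (length w)]"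
proof -
  let ?n = "length w"
  have c: "c \<le> ?n" using search_facts(3) .
  have dead: "\<not> pal (w @ [a]) x (Suc ?n - x)" if "x \<le> ?n" for x
  proof
    assume P: "pal (w @ [a]) x (Suc (length w) - x)"
    consider "c < x" | "x = c" | "x < c" by linarith
    then show False
    proof cases
      case 1
      then show ?thesis using search_facts(5) that P by blast
    next
      case 2
      then show ?thesis using max_radius_ge[OF k(1)] P k(2) c by fastforce
    next
      case 3
      then show ?thesis using dead_below P sc by fastforce
    qed
  qed
  show "suffix_radii (w @ [a]) s'" unfolding s'_def
  proof (rule suffix_radii_snoc[OF s refl])
    fix e assume e: "0 < e" "pal (w @ [a]) (Suc ?n - e) e"
    have "Suc ?n - e \<le> ?n" "Suc ?n - (Suc ?n - e) = e" using e pal_le[OF e(2)] by auto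
    then have "False" using dead[of "Suc ?n - e"] e by auto
    then show "0 < (0::nat) \<and> 0 \<le> e" ..
  qed simp
  show ch: "chain s' (Suc ?n) = [Suc ?n]" by (subst chain.simps) (simp add: s'_def)
  have "chain s c = [c]" using sc by (subst chain.simps) simp
  then show "radii (w @ [a]) s' (r(c := k))"
    using search_facts(6) k(1) ch by (auto simp: radii_def le_Suc_eq)
qed

end


section \<open>Total correctness with running time\<close>

definition wp :: "nat \<Rightarrow> com \<Rightarrow> (nat \<Rightarrow> 'a state \<Rightarrow> bool) \<Rightarrow> 'a state \<Rightarrow> bool" where
  "wp W c Q s \<longleftrightarrow> (\<exists>k s'. exec W c s k s' \<and> Q k s')"

lemma wp_Skip: "Q 1 s \<Longrightarrow> wp W Skip Q s"
  unfolding wp_def by (blast intro: exec.Skip)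

lemma wp_Assign:
  "aval e s \<le> W \<Longrightarrow> Q (1 + acost e) (s\<lparr>vars := (vars s)(x := aval e s)\<rparr>) \<Longrightarrow> wp W (Assign x e) Q s"
  unfolding wp_def by (blast intro: exec.Assign)

lemma wp_Store:
  "aval e1 s \<le> W \<Longrightarrow> aval e2 s \<le> W \<Longrightarrow>
   Q (1 + acost e1 + acost e2) (s\<lparr>arrs := (arrs s)(A := (arrs s A)(aval e1 s := aval e2 s))\<rparr>) \<Longrightarrow>
   wp W (Store A e1 e2) Q s"
  unfolding wp_def by (blast intro: exec.Store)

lemma wp_Read:
  "aval e s \<le> W \<Longrightarrow> inp s = a # as \<Longrightarrow>
   Q (1 + acost e) (s\<lparr>letters := (letters s)(A := (letters s A)(aval e s := Some a)), inp := as\<rparr>) \<Longrightarrow>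
   wp W (Read A e) Q s"
  unfolding wp_def by (blast intro: exec.Read)

lemma wp_Write:
  "letters s A (aval e s) = Some a \<Longrightarrow> Q (1 + acost e) (s\<lparr>outp := outp s @ [a]\<rparr>) \<Longrightarrow>
   wp W (Write A e) Q s"
  unfolding wp_def by (blast intro: exec.Write)

lemma wp_Seq: "wp W c1 (\<lambda>k s'. wp W c2 (\<lambda>k'. Q (k + k')) s') s \<Longrightarrow> wp W (Seq c1 c2) Q s"
  unfolding wp_def by (blast intro: exec.Seq)

lemma wp_Cond:
  "(bval b s \<Longrightarrow> wp W c1 (\<lambda>k. Q (bcost b + k)) s) \<Longrightarrow>
   (\<not> bval b s \<Longrightarrow> wp W c2 (\<lambda>k. Q (bcost b + k)) s) \<Longrightarrow> wp W (Cond b c1 c2) Q s"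
  unfolding wp_def by (cases "bval b s") (blast intro: exec.CondTrue exec.CondFalse)+

lemma bcost_pos: "0 < bcost b"
  by (cases b) auto

text \<open>The potential pays for the guard and the body of each iteration. As every guard costs at
  least one unit, it also proves termination; the additional \<open>bcost b\<close> is the failing
  guard.\<close>

lemma wp_Loop:
  fixes \<Phi> :: "'a state \<Rightarrow> nat"
  assumes "I s"
    and body: "\<And>s. I s \<Longrightarrow> bval b s \<Longrightarrow> wp W c (\<lambda>k s'. I s' \<and> bcost b + k + \<Phi> s' \<le> \<Phi> s) s"
    and post: "\<And>k s'. I s' \<Longrightarrow> \<not> bval b s' \<Longrightarrow> k + \<Phi> s' \<le> \<Phi> s + bcost b \<Longrightarrow> Q k s'"
  shows "wp W (Loop b c) Q s"
proof -
  have "\<exists>k s'. exec W (Loop b c) s k s' \<and> I s' \<and> \<not> bval b s' \<and> k + \<Phi> s' \<le> \<Phi> s + bcost b"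
    using assms(1)
  proof (induction "\<Phi> s" arbitrary: s rule: less_induct)
    case less
    show ?case
    proof (cases "bval b s")
      case False
      then show ?thesis using less.prems by (auto intro!: exI exec.LoopFalse)
    next
      case True
      then obtain k1 s1 where 1: "exec W c s k1 s1" "I s1" "bcost b + k1 + \<Phi> s1 \<le> \<Phi> s"
        using body[OF less.prems] by (auto simp: wp_def)
      then have "\<Phi> s1 < \<Phi> s" using bcost_pos[of b] by simp
      then obtain k2 s2 where 2: "exec W (Loop b c) s1 k2 s2" "I s2" "\<not> bval b s2"
        "k2 + \<Phi> s2 \<le> \<Phi> s1 + bcost b"
        using less.hyps 1(2) by blast
      have "exec W (Loop b c) s (bcost b + k1 + k2) s2" using exec.LoopTrue[OF True 1(1) 2(1)] .
      moreover have "bcost b + k1 + k2 + \<Phi> s2 \<le> \<Phi> s + bcost b" using 1 2 by simp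
      ultimately show ?thesis using 2 by blast
    qed
  qed
  then show ?thesis using post unfolding wp_def by blast
qed

section \<open>The program\<close>

text \<open>
  Letter array \<open>w\<close>: the current irreducible string, of length \<open>n\<close>. Array \<open>s\<close>: radii of the shortest
  even suffix palindromes of its prefixes, \<open>0\<close> if there is none. Array \<open>r\<close>: maximal radii of the
  centres outside the chain. Array \<open>t\<close> with stack pointer \<open>p\<close>: the centres already rejected in the
  current search that are not dominated by a later one; \<open>t[0]\<close> is a sentinel. Flag \<open>f\<close>: \<open>0\<close> while
  searching, \<open>1\<close> for success and \<open>2\<close> for failure.
\<close>

definition mirror_exp :: aexp where
  "mirror_exp = Minus (Plus (V ''c'') (V ''c'')) (Arr ''t'' (V ''p''))"

definition pop_cond :: bexp where
  "pop_cond = Conj (Leq (N 1) (V ''p''))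
     (Conj (Leq (Arr ''r'' (Arr ''t'' (V ''p''))) (Arr ''r'' mirror_exp))
           (Leq (Arr ''r'' mirror_exp) (Arr ''r'' (Arr ''t'' (V ''p'')))))"

definition pop_loop :: com where
  "pop_loop = Loop pop_cond (Assign ''p'' (Minus (V ''p'') (N 1)))"

definition push_com :: com where
  "push_com = Seq (Assign ''p'' (Plus (V ''p'') (N 1))) (Store ''t'' (V ''p'') (V ''c''))"

definition test_com :: com where
  "test_com = Cond (Conj (Leq (Plus (V ''n'') (N 1)) (Plus (V ''c'') (V ''c'')))
       (LetterEq ''w'' (V ''n'') ''w'' (Minus (Plus (V ''c'') (V ''c'')) (Plus (V ''n'') (N 1)))))
     (Assign ''f'' (N 1))
     (Seq (Store ''r'' (V ''c'') (Minus (V ''n'') (V ''c''))) push_com)"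

definition reject_com :: com where
  "reject_com = Seq
     (Cond (Leq (Arr ''r'' (Arr ''t'' (V ''p''))) (Arr ''r'' mirror_exp))
       (Store ''r'' (V ''c'') (Plus (Minus (Arr ''t'' (V ''p'')) (V ''c'')) (Arr ''r'' (Arr ''t'' (V ''p'')))))
       (Store ''r'' (V ''c'') (Plus (Minus (Arr ''t'' (V ''p'')) (V ''c'')) (Arr ''r'' mirror_exp))))
     push_com"

definition advance_com :: com where
  "advance_com = Cond (Leq (N 1) (V ''f'')) Skip
     (Cond (Leq (Arr ''s'' (V ''c'')) (N 0)) (Assign ''f'' (N 2))
       (Assign ''c'' (Minus (V ''c'') (Arr ''s'' (V ''c'')))))"

definition search_body :: com where
  "search_body = Seq pop_loop (Seq (Cond (Leq (V ''p'') (N 0)) test_com reject_com) advance_com)"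

definition search_com :: com where
  "search_com = Loop (Leq (V ''f'') (N 0)) search_body"

definition read_com :: com where
  "read_com = Seq (Read ''w'' (V ''n'')) (Seq (Assign ''c'' (V ''n'')) (Seq (Assign ''p'' (N 0))
     (Seq (Assign ''f'' (N 0)) (Store ''t'' (N 0) (V ''n'')))))"

definition extend_com :: com where
  "extend_com = Seq (Assign ''n'' (Plus (V ''n'') (N 1)))
     (Cond (Leq (V ''f'') (N 1)) (Store ''s'' (V ''n'') (Minus (V ''n'') (V ''c'')))
       (Store ''s'' (V ''n'') (N 0)))"

definition reduce_com :: com where
  "reduce_com = Seq (Assign ''d'' (Arr ''s'' (V ''n'')))
     (Cond (Conj (Leq (N 1) (V ''d''))
         (Conj (Leq (Arr ''s'' (Minus (V ''n'') (V ''d''))) (V ''d''))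
               (Leq (V ''d'') (Arr ''s'' (Minus (V ''n'') (V ''d''))))))
       (Assign ''n'' (Minus (V ''n'') (Plus (V ''d'') (V ''d''))))
       Skip)"

definition main_com :: com where
  "main_com = Loop (Neg EndOfInput) (Seq read_com (Seq search_com (Seq extend_com reduce_com)))"

definition output_com :: com where
  "output_com = Seq (Assign ''i'' (N 0)) (Loop (Leq (Plus (V ''i'') (N 1)) (V ''n''))
     (Seq (Write ''w'' (V ''i'')) (Assign ''i'' (Plus (V ''i'') (N 1)))))"

section \<open>Correctness and cost of the search\<close>

lemma wp_pop_loop:
  fixes st :: "'a state"
  assumes irr: "Z_irreducible w" and s: "suffix_radii w s"
    and inv: "search_inv w a s (arrs st ''r'') (arrs st ''t'') (vars st ''p'') c"
    and c: "vars st ''c'' = c" and W: "length w \<le> W"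
    and post: "\<And>k p. search_inv w a s (arrs st ''r'') (arrs st ''t'') p c \<Longrightarrow>
      1 \<le> p \<Longrightarrow> arrs st ''r'' (arrs st ''t'' p) \<noteq> arrs st ''r'' (2 * c - arrs st ''t'' p) \<Longrightarrow>
      k + 50 * p \<le> 50 * vars st ''p'' + 50 \<Longrightarrow> Q k (st\<lparr>vars := (vars st)(''p'' := p)\<rparr>)"
    and post0: "\<And>k. search_inv w a s (arrs st ''r'') (arrs st ''t'') 0 c \<Longrightarrow>
      k \<le> 50 * vars st ''p'' + 50 \<Longrightarrow> Q k (st\<lparr>vars := (vars st)(''p'' := 0)\<rparr>)"
  shows "wp W pop_loop Q st"
  unfolding pop_loop_def
\<comment> \<open>The factor 50 exceeds the cost of one guard and one decrement, so each popped
  entry pays for its own removal.\<close>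
proof (rule wp_Loop[where \<Phi> = "\<lambda>u. 50 * vars u ''p''"
      and I = "\<lambda>u. \<exists>p. u = st\<lparr>vars := (vars st)(''p'' := p)\<rparr> \<and>
        search_inv w a s (arrs st ''r'') (arrs st ''t'') p c"])
  show "\<exists>p. st = st\<lparr>vars := (vars st)(''p'' := p)\<rparr> \<and>
      search_inv w a s (arrs st ''r'') (arrs st ''t'') p c"
    using inv by (intro exI[of _ "vars st ''p''"]) simp
next
  fix u assume "\<exists>p. u = st\<lparr>vars := (vars st)(''p'' := p)\<rparr> \<and>
      search_inv w a s (arrs st ''r'') (arrs st ''t'') p c" and b: "bval pop_cond u"
  then obtain p where u: "u = st\<lparr>vars := (vars st)(''p'' := p)\<rparr>"
    and i: "search_inv w a s (arrs st ''r'') (arrs st ''t'') p c" by blast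
  have p: "1 \<le> p" "arrs st ''r'' (arrs st ''t'' p) = arrs st ''r'' (2 * c - arrs st ''t'' p)"
    using b c by (auto simp: u pop_cond_def mirror_exp_def mult_2)
  have i': "search_inv w a s (arrs st ''r'') (arrs st ''t'') (p - 1) c"
    using search_pop[OF irr s i p] .
  have "p \<le> W" using search_facts(4)[OF irr s i] W by simp
  then show "wp W (Assign ''p'' (Minus (V ''p'') (N 1)))
     (\<lambda>k s'. (\<exists>p. s' = st\<lparr>vars := (vars st)(''p'' := p)\<rparr> \<and>
        search_inv w a s (arrs st ''r'') (arrs st ''t'') p c) \<and>
        bcost pop_cond + k + 50 * vars s' ''p'' \<le> 50 * vars u ''p'') u"
    using p(1) i' by (intro wp_Assign) (auto simp: u pop_cond_def mirror_exp_def)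
next
  fix k u assume "\<exists>p. u = st\<lparr>vars := (vars st)(''p'' := p)\<rparr> \<and>
      search_inv w a s (arrs st ''r'') (arrs st ''t'') p c" and b: "\<not> bval pop_cond u"
    and k: "k + 50 * vars u ''p'' \<le> 50 * vars st ''p'' + bcost pop_cond"
  then obtain p where u: "u = st\<lparr>vars := (vars st)(''p'' := p)\<rparr>"
    and i: "search_inv w a s (arrs st ''r'') (arrs st ''t'') p c" by blast
  have k': "k + 50 * p \<le> 50 * vars st ''p'' + 50"
    using k by (simp add: u pop_cond_def mirror_exp_def)
  show "Q k u"
  proof (cases "p = 0")
    case True
    then show ?thesis using post0 i k' u by simp
  next
    case False
    then have "arrs st ''r'' (arrs st ''t'' p) \<noteq> arrs st ''r'' (2 * c - arrs st ''t'' p)"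
      using b c by (auto simp: u pop_cond_def mirror_exp_def mult_2)
    then show ?thesis using post i k' u False by simp
  qed
qed

text \<open>Failure leaves no candidate to describe, so the third case records instead that storing
  0 for the new length is correct.\<close>

definition search_state :: "'a list \<Rightarrow> 'a \<Rightarrow> 'a list \<Rightarrow> (nat \<Rightarrow> nat) \<Rightarrow> 'a state \<Rightarrow> bool" where
  "search_state w a as s st \<longleftrightarrow>
     vars st ''n'' = length w \<and> (\<forall>i\<le>length w. letters st ''w'' i = Some ((w @ [a]) ! i)) \<and>
     inp st = as \<and> outp st = [] \<and> arrs st ''s'' = s \<and>
     (vars st ''f'' = 0 \<and>
        search_inv w a s (arrs st ''r'') (arrs st ''t'') (vars st ''p'') (vars st ''c'') \<or>
      vars st ''f'' = 1 \<and> pal (w @ [a]) (vars st ''c'') (Suc (length w) - vars st ''c'') \<and>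
        search_inv w a s (arrs st ''r'') (arrs st ''t'') (vars st ''p'') (vars st ''c'') \<or>
      vars st ''f'' = 2 \<and> suffix_radii (w @ [a]) (s(Suc (length w) := 0)) \<and>
        radii (w @ [a]) (s(Suc (length w) := 0)) (arrs st ''r''))"

text \<open>The constants only have to dominate the cost of one iteration of the respective loop. Every
  iteration of the search removes an element from the chain, up to the one added by the new letter.\<close>

definition search_potential :: "(nat \<Rightarrow> nat) \<Rightarrow> 'a state \<Rightarrow> nat" where
  "search_potential s st =
     (if vars st ''f'' = 0 then 300 * (length (chain s (vars st ''c'')) + 1) + 50 * vars st ''p''
      else if vars st ''f'' = 1 then 300 * length (chain s (vars st ''c''))
      else 0)"

text \<open>Both ways of rejecting a candidate end with this push. The chain element given up
  contributes 300, which covers the 50 for the new stack entry and the running time.\<close>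

lemma wp_push_advance:
  fixes st :: "'a state"
  assumes irr: "Z_irreducible w" and s: "suffix_radii w s"
    and st: "vars st ''n'' = length w" "\<forall>i\<le>length w. letters st ''w'' i = Some ((w @ [a]) ! i)"
      "inp st = as" "outp st = []" "arrs st ''s'' = s" "vars st ''f'' = 0"
    and inv: "search_inv w a s r (arrs st ''t'') p (vars st ''c'')"
    and p: "vars st ''p'' = p"
    and r: "arrs st ''r'' = r(vars st ''c'' := k)"
    and k: "max_radius (w @ [a]) (vars st ''c'') k" "arrs st ''t'' p - vars st ''c'' \<le> k"
      "k \<le> length w - vars st ''c''"
    and W: "length w + 2 \<le> W"
    and Q: "\<And>i j st'. search_state w a as s st' \<Longrightarrow>
       i + j + search_potential s st' \<le> 300 * length (chain s (vars st ''c'')) + 50 * p + 120 \<Longrightarrow> Q i j st'"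
  shows "wp W push_com (\<lambda>i s'. wp W advance_com (\<lambda>j s''. Q i j s'') s') st"
proof -
  let ?c = "vars st ''c''"
  note f = search_facts[OF irr s inv]
  have W': "p + 1 \<le> W" "?c \<le> W" using f(3,4) W by auto
  have s2: "2 * s ?c \<le> ?c" using suffix_radii_le[OF s f(3)] .
  have nxt: "search_inv w a s (r(?c := k)) ((arrs st ''t'')(Suc p := ?c)) (Suc p) (?c - s ?c)" if "0 < s ?c"
    using search_next[OF irr s inv k that] .
  have len: "length (chain s ?c) = Suc (length (chain s (?c - s ?c)))" if "0 < s ?c"
    using chain_step[of s ?c] that s2 by simp
  have exh: "suffix_radii (w @ [a]) (s(Suc (length w) := 0))"
      "radii (w @ [a]) (s(Suc (length w) := 0)) (r(?c := k))" if "s ?c = 0"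
    using search_exhausted[OF irr s inv k(1,3) that] by blast+
  show ?thesis
    unfolding push_com_def advance_com_def
    apply (intro wp_Seq wp_Assign wp_Store wp_Cond wp_Skip)
    using W W' st p s2 apply (simp_all add: r)
    subgoal
      apply (rule Q)
       apply (simp add: search_state_def st r exh)
      apply (simp add: search_potential_def)
      done
    subgoal
      apply (rule Q)
       apply (simp add: search_state_def st r nxt)
      apply (simp add: search_potential_def len)
      done
    done
qed


lemma wp_state_eq: "wp W c Q u \<Longrightarrow> u = v \<Longrightarrow> wp W c Q v"
  by simp

text \<open>The summand 3 is the cost of the guard of the search loop.\<close>

lemma wp_search_body:
  fixes st :: "'a state"
  assumes irr: "Z_irreducible w" and s: "suffix_radii w s" and W: "length w + 2 \<le> W"
    and inv: "search_state w a as s st" and f0: "vars st ''f'' = 0"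
    and Q: "\<And>j st'. search_state w a as s st' \<Longrightarrow> 3 + j + search_potential s st' \<le> search_potential s st \<Longrightarrow> Q j st'"
  shows "wp W search_body Q st"
proof -
  let ?c = "vars st ''c''" and ?r = "arrs st ''r''" and ?t = "arrs st ''t''"
  have st: "vars st ''n'' = length w" "\<forall>i\<le>length w. letters st ''w'' i = Some ((w @ [a]) ! i)"
      "inp st = as" "outp st = []" "arrs st ''s'' = s"
    and si: "search_inv w a s ?r ?t (vars st ''p'') ?c"
    using inv f0 by (auto simp: search_state_def)
  have pot: "search_potential s st = 300 * length (chain s ?c) + 300 + 50 * vars st ''p''"
    using f0 by (simp add: search_potential_def)
  have push: "wp W push_com (\<lambda>i s'. wp W advance_com (\<lambda>j. R i j) s')
      (st\<lparr>vars := (vars st)(''p'' := p), arrs := (arrs st)(''r'' := ?r(?c := k))\<rparr>)"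
    if "search_inv w a s ?r ?t p ?c" "max_radius (w @ [a]) ?c k" "?t p - ?c \<le> k" "k \<le> length w - ?c"
      "\<And>i j st'. search_state w a as s st' \<Longrightarrow>
         i + j + search_potential s st' \<le> 300 * length (chain s ?c) + 50 * p + 120 \<Longrightarrow> R i j st'" for p k R
    by (rule wp_push_advance[OF irr s, where r = ?r and p = p and k = k and a = a and as = as])
      (use that st f0 W in \<open>simp_all\<close>)
  show ?thesis
    unfolding search_body_def
  proof (intro wp_Seq, rule wp_pop_loop[OF irr s si refl], goal_cases)
    case 1
    then show ?case using W by simp
  next
    case (2 k p)
    note k = search_radius[OF irr s 2(1,2,3)]
    let ?k = "?t p - ?c + min (?r (?t p)) (?r (2 * ?c - ?t p))"
    have rk: "?c \<le> W" "?k \<le> W" using k(3) search_facts(3)[OF irr s 2(1)] W by auto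
    show ?case
      unfolding reject_com_def
      by (intro wp_Seq wp_Cond wp_Store; (rule wp_state_eq[OF push[OF 2(1) k]])?)
        (use rk 2 pot in \<open>auto simp: mirror_exp_def mult_2[symmetric] min_def intro!: Q\<close>)
  next
    case (3 k)
    let ?n = "length w"
    note l = search_letter[OF irr s 3(1) refl]
    note f = search_facts[OF irr s 3(1)]
    have W': "?c \<le> W" "?n - ?c \<le> W" "1 \<le> W" using f(3) W by auto
    have t0: "?t 0 - ?c \<le> ?n - ?c" using f(2) by simp
    have cn: "2 * ?c - Suc ?n \<le> ?n" using f(3) by simp
    show ?case
    proof (cases "?n + 1 \<le> 2 * ?c \<and> (w @ [a]) ! ?n = (w @ [a]) ! (2 * ?c - (?n + 1))")
      case True
      then have P: "pal (w @ [a]) ?c (Suc ?n - ?c)" using l(1) by blast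
      show ?thesis
        unfolding test_com_def advance_com_def
        by (intro wp_Seq wp_Cond wp_Assign wp_Skip Q)
          (use True P W' st cn 3 pot in \<open>auto simp: mult_2[symmetric] search_state_def search_potential_def\<close>)
    next
      case False
      then have m: "max_radius (w @ [a]) ?c (?n - ?c)" using l(2) by blast
      show ?thesis
        unfolding test_com_def
        by (intro wp_Seq wp_Cond wp_Store; (rule wp_state_eq[OF push[OF 3(1) m t0 order_refl]])?)
        (use False W' st cn 3 pot in \<open>auto simp: mult_2[symmetric] intro!: Q\<close>)
    qed
  qed
qed

lemma wp_search_com:
  fixes st :: "'a state"
  assumes irr: "Z_irreducible w" and s: "suffix_radii w s" and W: "length w + 2 \<le> W"
    and inv: "search_state w a as s st"
    and Q: "\<And>j st'. search_state w a as s st' \<Longrightarrow> vars st' ''f'' \<noteq> 0 \<Longrightarrow>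
      j + search_potential s st' \<le> search_potential s st + 3 \<Longrightarrow> Q j st'"
  shows "wp W search_com Q st"
  unfolding search_com_def
proof (rule wp_Loop[where I = "search_state w a as s" and \<Phi> = "search_potential s"])
  show "search_state w a as s st" by fact
  show "wp W search_body (\<lambda>k s'. search_state w a as s s' \<and>
      bcost (Leq (V ''f'') (N 0)) + k + search_potential s s' \<le> search_potential s u) u"
    if "search_state w a as s u" "bval (Leq (V ''f'') (N 0)) u" for u
    using that by (intro wp_search_body[OF irr s W that(1)]) auto
qed (use Q in auto)

section \<open>The main loop and its potential\<close>

definition main_inv :: "'a list \<Rightarrow> 'a state \<Rightarrow> bool" where
  "main_inv T st \<longleftrightarrow> (\<exists>w v. T = v @ inp st \<and> length w \<le> length v \<and> Z_red\<^sup>*\<^sup>* v w \<and> Z_irreducible w \<and>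
     vars st ''n'' = length w \<and> (\<forall>i<length w. letters st ''w'' i = Some (w ! i)) \<and> outp st = [] \<and>
     suffix_radii w (arrs st ''s'') \<and> radii w (arrs st ''s'') (arrs st ''r''))"

text \<open>Every unread letter carries 1000 units: 300 for the element it may add to the chain, 300
  for one further iteration of the search, and the rest for constant costs.\<close>

definition main_potential :: "'a state \<Rightarrow> nat" where
  "main_potential st = 1000 * length (inp st) + 300 * length (chain (arrs st ''s'') (vars st ''n''))"

lemma Z_reds_append: "Z_red\<^sup>*\<^sup>* u v \<Longrightarrow> Z_red\<^sup>*\<^sup>* (u @ z) (v @ z)"
proof (induction rule: rtranclp_induct)
  case (step v v')
  then have "(v @ z) \<rightarrow>\<^sub>Z (v' @ z)" unfolding Z_red_def by force
  then show ?case using step by simp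
qed simp

text \<open>A reduction from length \<open>n\<close> to \<open>n - 2 * d\<close> removes exactly the chain elements \<open>n\<close> and \<open>n - d\<close>, so
  undoing letters never raises the potential.\<close>

lemma wp_reduce_com:
  fixes st :: "'a state"
  assumes irr: "Z_irreducible w" and w': "w' = w @ [a]"
    and s: "suffix_radii w' (arrs st ''s'')" "radii w' (arrs st ''s'') (arrs st ''r'')"
    and T: "T = v @ inp st" "length w' \<le> length v" "Z_red\<^sup>*\<^sup>* v w'"
    and st: "vars st ''n'' = length w'" "\<forall>i<length w'. letters st ''w'' i = Some (w' ! i)" "outp st = []"
    and W: "length w' \<le> W"
    and Q: "\<And>j st'. main_inv T st' \<Longrightarrow> j + main_potential st' \<le> main_potential st + 30 \<Longrightarrow> Q j st'"
  shows "wp W reduce_com Q st"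
proof -
  let ?s = "arrs st ''s''" and ?n = "length w'"
  let ?d = "?s ?n"
  have n: "?n = Suc (length w)" by (simp add: w')
  have dW: "?d \<le> W" using suffix_radii_le[OF s(1) order_refl] W by simp
  note iff = snoc_Z_irreducible_iff[OF irr s(1)[unfolded w'] n, folded w']
  show ?thesis
  proof (cases "0 < ?d \<and> ?s (?n - ?d) = ?d")
    case True
    let ?c = "?n - 2 * ?d"
    let ?w = "take ?c w'"
    note red = shortest_Z_reduce[OF s(1) refl True[THEN conjunct1] True[THEN conjunct2]]
    \<comment> \<open>Since \<open>0 < ?d\<close>, the truncation also removes the new letter, so
      what remains is a prefix of \<open>w\<close>.\<close>
    have "?w = take ?c w" using True red(2) by (simp add: w')
    then have irr': "Z_irreducible ?w" using Z_irreducible_take[OF irr] by metis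
    have reds: "Z_red\<^sup>*\<^sup>* v ?w" using T(3) red(1) by simp
    have le: "?c \<le> ?n" by simp
    have lw: "length ?w = ?c" by simp
    have "chain ?s ?n = ?n # (?n - ?d) # chain ?s ?c"
      using chain_step[of ?s ?n] chain_step[of ?s "?n - ?d"] True red(2)
      by (auto simp: w' mult_2)
    then have len: "length (chain ?s ?n) = Suc (Suc (length (chain ?s ?c)))" by simp
    have mi: "main_inv T u" if "inp u = inp st" "vars u ''n'' = ?c" "letters u = letters st"
      "outp u = []" "arrs u = arrs st" for u :: "'a state"
      unfolding main_inv_def
      by (intro exI[of _ ?w] exI[of _ v])
        (use that T irr' reds st suffix_radii_take[OF s(1) le] radii_take[OF s le] in auto)
    show ?thesis
      unfolding reduce_com_def
      by (intro wp_Seq wp_Cond wp_Assign wp_Skip Q mi)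
        (use True st dW W in \<open>auto simp: main_potential_def len mult_2\<close>)
  next
    case False
    then have irr': "Z_irreducible w'" using iff by blast
    have mi: "main_inv T u" if "inp u = inp st" "vars u ''n'' = ?n" "letters u = letters st"
      "outp u = []" "arrs u = arrs st" for u :: "'a state"
      unfolding main_inv_def by (intro exI[of _ w'] exI[of _ v]) (use that T irr' st s in auto)
    show ?thesis
      unfolding reduce_com_def
      by (intro wp_Seq wp_Cond wp_Assign wp_Skip Q mi)
        (use False st dW W in \<open>auto simp: main_potential_def\<close>)
  qed
qed

lemma wp_main_com:
  fixes T :: "'a list"
  assumes inv: "main_inv T st" and W: "length T + 2 \<le> W"
    and Q: "\<And>j st'. main_inv T st' \<Longrightarrow> inp st' = [] \<Longrightarrow> j \<le> main_potential st + 10 \<Longrightarrow> Q j st'"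
  shows "wp W main_com Q st"
  unfolding main_com_def
proof (rule wp_Loop[where I = "main_inv T" and \<Phi> = main_potential])
  fix u :: "'a state"
  assume "main_inv T u" "bval (Neg EndOfInput) u"
  then obtain w v a as where T: "T = v @ inp u" "length w \<le> length v" "Z_red\<^sup>*\<^sup>* v w"
    and irr: "Z_irreducible w" and u: "vars u ''n'' = length w"
      "\<forall>i<length w. letters u ''w'' i = Some (w ! i)" "outp u = []" "inp u = a # as"
    and s: "suffix_radii w (arrs u ''s'')" and r: "radii w (arrs u ''s'') (arrs u ''r'')"
    by (auto simp: main_inv_def neq_Nil_conv)
  let ?s = "arrs u ''s''" and ?n = "length w"
  have W': "?n + 2 \<le> W" "?n \<le> W" using T W by auto
  have fin: "wp W extend_com (\<lambda>k s'. wp W reduce_com (\<lambda>j. R k j) s') x"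
    if x: "search_state w a as ?s x" "vars x ''f'' \<noteq> 0"
      and R: "\<And>i j y. main_inv T y \<Longrightarrow>
        i + j + main_potential y \<le> 1000 * length as + search_potential ?s x + 400 \<Longrightarrow> R i j y" for x R
  proof -
    have lx: "vars x ''n'' = ?n" "inp x = as" "outp x = []" "arrs x ''s'' = ?s"
      "\<forall>i\<le>?n. letters x ''w'' i = Some ((w @ [a]) ! i)" using x by (auto simp: search_state_def)
    define val where "val = (if vars x ''f'' = 1 then Suc ?n - vars x ''c'' else 0)"
    define s' where "s' = ?s(Suc ?n := val)"
    have "val \<le> Suc ?n" by (simp add: val_def)
    have main: "suffix_radii (w @ [a]) s' \<and> radii (w @ [a]) s' (arrs x ''r'') \<and>
      300 * length (chain s' (Suc ?n)) = search_potential ?s x + 300"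
    proof (cases "vars x ''f'' = 1")
      case True
      then have "pal (w @ [a]) (vars x ''c'') (Suc ?n - vars x ''c'')"
        and si: "search_inv w a ?s (arrs x ''r'') (arrs x ''t'') (vars x ''p'') (vars x ''c'')"
        using x by (auto simp: search_state_def)
      then show ?thesis
        using search_found[OF irr s si] True by (simp add: s'_def val_def search_potential_def)
    next
      case False
      then have "suffix_radii (w @ [a]) s'" "radii (w @ [a]) s' (arrs x ''r'')"
        using x by (auto simp: search_state_def s'_def val_def)
      moreover have "chain s' (Suc ?n) = [Suc ?n]"
        using False by (subst chain.simps) (simp add: s'_def val_def)
      ultimately show ?thesis using x(2) False by (simp add: search_potential_def)
    qed
    let ?y = "x\<lparr>vars := (vars x)(''n'' := Suc ?n), arrs := (arrs x)(''s'' := s')\<rparr>"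
    have red: "wp W reduce_com (\<lambda>j. R i j) ?y" if "i \<le> 30" for i
    proof (rule wp_reduce_com[OF irr refl, where a = a and T = T and v = "v @ [a]"])
      show "Z_red\<^sup>*\<^sup>* (v @ [a]) (w @ [a])" using Z_reds_append[OF T(3)] .
      fix j y assume "main_inv T y" "j + main_potential y \<le> main_potential ?y + 30"
      then show "R i j y" using main that lx by (intro R) (auto simp: main_potential_def)
    qed (use main lx T u W' in auto)
    have f2: "\<not> vars x ''f'' \<le> 1" if "vars x ''f'' \<noteq> 1" using x that by (auto simp: search_state_def)
    show ?thesis
      unfolding extend_com_def
      by (intro wp_Seq wp_Cond wp_Assign wp_Store; (rule wp_state_eq[OF red])?)
        (use lx W' \<open>val \<le> Suc ?n\<close> f2 x(2) in \<open>auto simp: s'_def val_def le_Suc_eq\<close>)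
  qed
  define u' where "u' = u\<lparr>letters := (letters u)(''w'' := (letters u ''w'')(?n := Some a)), inp := as,
     vars := (vars u)(''c'' := ?n, ''p'' := 0, ''f'' := 0),
     arrs := (arrs u)(''t'' := (arrs u ''t'')(0 := ?n))\<rparr>"
  have fi: "search_state w a as ?s u'"
    using u search_inv_init[OF s r, of "(arrs u ''t'')(0 := ?n)" a]
    by (auto simp: u'_def search_state_def nth_append)
  have sp: "search_potential ?s u' = 300 * length (chain ?s ?n) + 300"
    by (simp add: u'_def search_potential_def)
  have rest: "wp W search_com (\<lambda>i s'. wp W (Seq extend_com reduce_com) (\<lambda>j. R i j) s') u'"
    if R: "\<And>i j y. main_inv T y \<Longrightarrow>
        i + j + main_potential y \<le> 1000 * length as + 300 * length (chain ?s ?n) + 800 \<Longrightarrow> R i j y" for R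
    by (rule wp_search_com[OF irr s W'(1) fi], rule wp_Seq, rule fin) (use sp in \<open>auto intro!: R\<close>)
  show "wp W (Seq read_com (Seq search_com (Seq extend_com reduce_com)))
     (\<lambda>k s'. main_inv T s' \<and> bcost (Neg EndOfInput) + k + main_potential s' \<le> main_potential u) u"
    unfolding read_com_def
    by (intro wp_Seq wp_Read[OF _ u(4)] wp_Assign wp_Store; (rule wp_state_eq[OF rest])?)
      (use u W' in \<open>auto simp: u'_def main_potential_def\<close>)
qed (use inv Q in auto)


section \<open>Output and the linear bound\<close>

lemma wp_output_com:
  fixes st :: "'a state"
  assumes st: "vars st ''n'' = length w" "\<forall>i<length w. letters st ''w'' i = Some (w ! i)" "outp st = []"
    and W: "length w \<le> W"
    and Q: "\<And>j st'. outp st' = w \<Longrightarrow> j \<le> 20 * length w + 10 \<Longrightarrow> Q j st'"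
  shows "wp W output_com Q st"
proof -
  let ?I = "\<lambda>u. vars u ''n'' = length w \<and> letters u = letters st \<and> vars u ''i'' \<le> length w \<and>
    outp u = take (vars u ''i'') w"
  let ?\<Phi> = "\<lambda>u. 20 * (length w - vars u ''i'')"
  have loop: "wp W (Loop (Leq (Plus (V ''i'') (N 1)) (V ''n''))
     (Seq (Write ''w'' (V ''i'')) (Assign ''i'' (Plus (V ''i'') (N 1))))) R u"
    if u: "?I u" "vars u ''i'' = 0"
      and R: "\<And>j st'. outp st' = w \<Longrightarrow> j \<le> 20 * length w + 5 \<Longrightarrow> R j st'" for R u
  proof (rule wp_Loop[where I = ?I and \<Phi> = ?\<Phi>], fact u(1))
    fix x :: "'a state" assume x: "?I x" "bval (Leq (Plus (V ''i'') (N 1)) (V ''n'')) x"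
    then have i: "vars x ''i'' < length w" by simp
    then have l: "letters x ''w'' (aval (V ''i'') x) = Some (w ! vars x ''i'')" using x st by simp
    show "wp W (Seq (Write ''w'' (V ''i'')) (Assign ''i'' (Plus (V ''i'') (N 1))))
     (\<lambda>k s'. ?I s' \<and> bcost (Leq (Plus (V ''i'') (N 1)) (V ''n'')) + k + ?\<Phi> s' \<le> ?\<Phi> x) x"
      by (intro wp_Seq wp_Write[OF l] wp_Assign)
        (use x i W in \<open>auto simp: take_Suc_conv_app_nth\<close>)
  qed (use u R in auto)
  show ?thesis
    unfolding output_com_def
    by (intro wp_Seq wp_Assign loop) (use st in \<open>auto intro!: Q\<close>)
qed

lemma main_inv_init:
  fixes T :: "'a list"
  shows "main_inv T (init T)"
proof -
  have "Z_irreducible ([] :: 'a list)" by (auto simp: Z_irreducible_iff_Z_at Z_at_def pal_def)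
  moreover have "suffix_radii ([] :: 'a list) (\<lambda>_. 0)" by (auto simp: suffix_radii_def pal_def)
  moreover have "radii ([] :: 'a list) (\<lambda>_. 0) r" for r by (simp add: radii_def chain_self)
  ultimately show ?thesis unfolding main_inv_def by (intro exI[of _ "[]"]) (simp add: init_def)
qed

theorem theorem2:
  shows "\<exists>c W time. (\<lambda>n. real (W n)) \<in> O(\<lambda>n. real n) \<and> (\<lambda>n. real (time n)) \<in> O(\<lambda>n. real n) \<and>
    computes c (Z_nf :: 'a list \<Rightarrow> 'a list) W time"
proof (intro exI conjI)
  \<comment> \<open>The main loop costs at most \<open>1000 * n + 310\<close> and the output at most
    \<open>20 * n + 10\<close>. The word bound leaves room for the flag value 2.\<close>
  let ?W = "\<lambda>n::nat. n + 2" and ?time = "\<lambda>n::nat. 1020 * n + 400"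
  show "(\<lambda>n. real (?W n)) \<in> O(\<lambda>n. real n)"
    by (intro bigoI[of _ 3] eventually_sequentiallyI[of 1]) simp
  show "(\<lambda>n. real (?time n)) \<in> O(\<lambda>n. real n)"
    by (intro bigoI[of _ 1420] eventually_sequentiallyI[of 1]) simp
  show "computes (Seq main_com output_com) (Z_nf :: 'a list \<Rightarrow> 'a list) ?W ?time"
    unfolding computes_def
  proof
    fix T :: "'a list"
    have pot: "main_potential (init T) = 1000 * length T + 300"
      by (simp add: main_potential_def init_def chain.simps)
    have "wp (?W (length T)) (Seq main_com output_com)
        (\<lambda>k s. outp s = Z_nf T \<and> k \<le> ?time (length T)) (init T)"
    proof (intro wp_Seq wp_main_com[OF main_inv_init])
      fix j and st' :: "'a state"
      assume "main_inv T st'" "inp st' = []" and j: "j \<le> main_potential (init T) + 10"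
      then obtain w where w: "length w \<le> length T" "Z_red\<^sup>*\<^sup>* T w" "Z_irreducible w"
        "vars st' ''n'' = length w" "\<forall>i<length w. letters st' ''w'' i = Some (w ! i)" "outp st' = []"
        by (auto simp: main_inv_def)
      show "wp (?W (length T)) output_com
          (\<lambda>k s. outp s = Z_nf T \<and> j + k \<le> ?time (length T)) st'"
        by (rule wp_output_com[OF w(4-6)]) (use w(1) j pot Z_nf_eqI[OF w(2,3)] in auto)
    qed simp
    then show "\<exists>k s. exec (?W (length T)) (Seq main_com output_com) (init T) k s \<and> outp s = Z_nf T \<and>
        k \<le> ?time (length T)"
      unfolding wp_def by blast
  qed
qed

end
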